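(* Let $\mathcal{C}$ be a compact dagger category and $(A,m,e)$ a monoid in $\mathcal{C}$. Define $i\colon A\to A^*$ by $i=(\mathrm{id}_{A^*}\otimes(e^\dagger\circ m))\circ(u_A\otimes\mathrm{id}_A)$ and $R\colon A\to A^*\otimes A$ by $R=(\mathrm{id}_{A^*}\otimes m)\circ(u_A\otimes\mathrm{id}_A)$ (modulo coherence isomorphisms). Then $(A,m,e)$ is a Frobenius monoid if and only if $i$ is an involution making $A$ an involutive monoid and $R$ is a homomorphism of involutive monoids from $(A,m,e,i)$ to $A^*\otimes A$ equipped with the pair-of-pants monoid structure and the identity involution.
   Context: A dagger category has an identity-on-objects involutive contravariant functor $f\mapsto f^\dagger$. A compact dagger category is a symmetric monoidal dagger category (dagger with $(f\otimes g)^\dagger=f^\dagger\otimes g^\dagger$ and unitary coherence isomorphisms and symmetries $\sigma$) in which each object $A$ has a chosen dual $A^*$ and $u_A\colon I\to A^*\otimes A$ such that with $c_A=u_A^\dagger\circ\sigma_{A,A^*}\colon A\otimes A^*\to I$ the snake identities $(c_A\otimes\mathrm{id}_A)\circ(\mathrm{id}_A\otimes u_A)=\mathrm{id}_A$ and $(\mathrm{id}_{A^*}\otimes c_A)\circ(u_A\otimes\mathrm{id}_{A^*})=\mathrm{id}_{A^*}$ hold; conventions $A^{**}=A$, $(A\otimes B)^*=B^*\otimes A^*$, $I^*=I$. For $f\colon A\to B$, $f_*\colon A^*\to B^*$ is the transpose of $f^\dagger$: $f_*=(\mathrm{id}_{B^*}\otimes c_A)\circ(\mathrm{id}_{B^*}\otimes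 f^\dagger\otimes\mathrm{id}_{A^*})\circ(u_B\otimes\mathrm{id}_{A^*})$. For a monoid $(A,m,e)$, $A^*$ is a monoid (the opposite monoid) with multiplication $m_*\colon A^*\otimes A^*\to A^*$ and unit $e_*$. A monoid homomorphism preserves multiplication and unit. A monoid $(A,m,e)$ is a Frobenius monoid if $(\mathrm{id}_A\otimes m)\circ(m^\dagger\otimes\mathrm{id}_A)=(m\otimes\mathrm{id}_A)\circ(\mathrm{id}_A\otimes m^\dagger)$ (modulo associators). An involutive monoid is a monoid $A$ together with a monoid homomorphism $i\colon A\to A^*$ (into the opposite monoid) with $i_*\circ i=\mathrm{id}_A$; a homomorphism of involutive monoids $(A,i)\to(B,j)$ is a monoid homomorphism $f$ with $j\circ f=f_*\circ i$. The pair-of-pants monoid on $A^*\otimes A$ has multiplication $\mathrm{id}_{A^*}\otimes c_A\otimes\mathrm{id}_A$ and unit $u_A$; since $(A^*\otimes A)^*=A^{**}\otimes A^*$... with the conventions $(A^*\otimes A)^*=A^*\otimes A$, and its involution is taken to be the identity.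
   Formalization: The conventions A**=A, (A⊗B)*=B*⊗A*, I*=I are taken to identify the chosen cups too: u_{A*}=σ∘u_A, u_{A⊗B} is u_A nested inside u_B, and u_I is the canonical isomorphism; with equality of objects alone the claim fails (e.g. u_{A*}=−σ∘u_A). *)

theory Defs
  imports Main
begin

record ('o, 'a) compact_dagger_data =
  obj :: "'o set"
  hom :: "'o \<Rightarrow> 'o \<Rightarrow> 'a set"
  ident :: "'o \<Rightarrow> 'a"
  comp :: "'a \<Rightarrow> 'a \<Rightarrow> 'a" (infixr "\<cdot>\<index>" 55)
  dagger :: "'a \<Rightarrow> 'a" ("_\<^sup>\<dagger>\<index>" [1000] 999)
  tensor_obj :: "'o \<Rightarrow> 'o \<Rightarrow> 'o" (infixr "\<odot>\<index>" 70)
  unit_obj :: "'o" ("\<one>\<index>")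
  tensor :: "'a \<Rightarrow> 'a \<Rightarrow> 'a" (infixr "\<otimes>\<index>" 70)
  associator :: "'o \<Rightarrow> 'o \<Rightarrow> 'o \<Rightarrow> 'a"
  left_unitor :: "'o \<Rightarrow> 'a"
  right_unitor :: "'o \<Rightarrow> 'a"
  symmetry :: "'o \<Rightarrow> 'o \<Rightarrow> 'a"
  dual :: "'o \<Rightarrow> 'o" ("_\<^sup>\<star>\<index>" [1000] 999)
  cup :: "'o \<Rightarrow> 'a"

definition is_iso :: "('o, 'a, 'z) compact_dagger_data_scheme \<Rightarrow> 'o \<Rightarrow> 'o \<Rightarrow> 'a \<Rightarrow> bool" where
  "is_iso C A B f \<longleftrightarrow> f \<in> hom C A B \<and>
     (\<exists>g \<in> hom C B A. g \<cdot>\<^bsub>C\<^esub> f = ident C A \<and> f \<cdot>\<^bsub>C\<^esub> g = ident C B)"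

definition unitary :: "('o, 'a, 'z) compact_dagger_data_scheme \<Rightarrow> 'o \<Rightarrow> 'o \<Rightarrow> 'a \<Rightarrow> bool" where
  "unitary C A B f \<longleftrightarrow> f \<in> hom C A B \<and>
     f\<^sup>\<dagger>\<^bsub>C\<^esub> \<cdot>\<^bsub>C\<^esub> f = ident C A \<and> f \<cdot>\<^bsub>C\<^esub> f\<^sup>\<dagger>\<^bsub>C\<^esub> = ident C B"

locale category =
  fixes C :: "('o, 'a, 'z) compact_dagger_data_scheme" (structure)
  assumes hom_obj: "f \<in> hom C A B \<Longrightarrow> A \<in> obj C \<and> B \<in> obj C"
    and hom_disjoint: "\<lbrakk>f \<in> hom C A B; f \<in> hom C A' B'\<rbrakk> \<Longrightarrow> A = A' \<and> B = B'"
    and ident_hom: "A \<in> obj C \<Longrightarrow> ident C A \<in> hom C A A"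
    and comp_hom: "\<lbrakk>f \<in> hom C A B; g \<in> hom C B D\<rbrakk> \<Longrightarrow> g \<cdot> f \<in> hom C A D"
    and ident_left: "f \<in> hom C A B \<Longrightarrow> ident C B \<cdot> f = f"
    and ident_right: "f \<in> hom C A B \<Longrightarrow> f \<cdot> ident C A = f"
    and comp_assoc:
      "\<lbrakk>f \<in> hom C A B; g \<in> hom C B D; h \<in> hom C D E\<rbrakk> \<Longrightarrow> (h \<cdot> g) \<cdot> f = h \<cdot> (g \<cdot> f)"

locale dagger_category = category +
  assumes dagger_hom: "f \<in> hom C A B \<Longrightarrow> f\<^sup>\<dagger> \<in> hom C B A"
    and dagger_ident: "A \<in> obj C \<Longrightarrow> (ident C A)\<^sup>\<dagger> = ident C A"
    and dagger_comp: "\<lbrakk>f \<in> hom C A B; g \<in> hom C B D\<rbrakk> \<Longrightarrow> (g \<cdot> f)\<^sup>\<dagger> = f\<^sup>\<dagger> \<cdot> g\<^sup>\<dagger>"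
    and dagger_dagger: "f \<in> hom C A B \<Longrightarrow> (f\<^sup>\<dagger>)\<^sup>\<dagger> = f"

locale symmetric_monoidal_category = category +
  assumes unit_obj: "\<one> \<in> obj C"
    and tensor_obj: "\<lbrakk>A \<in> obj C; B \<in> obj C\<rbrakk> \<Longrightarrow> A \<odot> B \<in> obj C"
    and tensor_hom:
      "\<lbrakk>f \<in> hom C A B; g \<in> hom C A' B'\<rbrakk> \<Longrightarrow> f \<otimes> g \<in> hom C (A \<odot> A') (B \<odot> B')"
    and tensor_ident:
      "\<lbrakk>A \<in> obj C; B \<in> obj C\<rbrakk> \<Longrightarrow> ident C A \<otimes> ident C B = ident C (A \<odot> B)"
    and tensor_comp:
      "\<lbrakk>f \<in> hom C A B; g \<in> hom C B D; f' \<in> hom C A' B'; g' \<in> hom C B' D'\<rbrakk>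
        \<Longrightarrow> (g \<cdot> f) \<otimes> (g' \<cdot> f') = (g \<otimes> g') \<cdot> (f \<otimes> f')"
    and associator_iso:
      "\<lbrakk>A \<in> obj C; B \<in> obj C; D \<in> obj C\<rbrakk>
        \<Longrightarrow> is_iso C ((A \<odot> B) \<odot> D) (A \<odot> (B \<odot> D)) (associator C A B D)"
    and associator_natural:
      "\<lbrakk>f \<in> hom C A A'; g \<in> hom C B B'; h \<in> hom C D D'\<rbrakk>
        \<Longrightarrow> associator C A' B' D' \<cdot> ((f \<otimes> g) \<otimes> h) = (f \<otimes> (g \<otimes> h)) \<cdot> associator C A B D"
    and left_unitor_iso: "A \<in> obj C \<Longrightarrow> is_iso C (\<one> \<odot> A) A (left_unitor C A)"
    and left_unitor_natural:
      "f \<in> hom C A B \<Longrightarrow> left_unitor C B \<cdot> (ident C \<one> \<otimes> f) = f \<cdot> left_unitor C A"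
    and right_unitor_iso: "A \<in> obj C \<Longrightarrow> is_iso C (A \<odot> \<one>) A (right_unitor C A)"
    and right_unitor_natural:
      "f \<in> hom C A B \<Longrightarrow> right_unitor C B \<cdot> (f \<otimes> ident C \<one>) = f \<cdot> right_unitor C A"
    and pentagon:
      "\<lbrakk>A \<in> obj C; B \<in> obj C; D \<in> obj C; E \<in> obj C\<rbrakk>
        \<Longrightarrow> (ident C A \<otimes> associator C B D E) \<cdot> associator C A (B \<odot> D) E
              \<cdot> (associator C A B D \<otimes> ident C E)
            = associator C A B (D \<odot> E) \<cdot> associator C (A \<odot> B) D E"
    and triangle:
      "\<lbrakk>A \<in> obj C; B \<in> obj C\<rbrakk>
        \<Longrightarrow> (ident C A \<otimes> left_unitor C B) \<cdot> associator C A \<one> B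
            = right_unitor C A \<otimes> ident C B"
    and symmetry_hom:
      "\<lbrakk>A \<in> obj C; B \<in> obj C\<rbrakk> \<Longrightarrow> symmetry C A B \<in> hom C (A \<odot> B) (B \<odot> A)"
    and symmetry_natural:
      "\<lbrakk>f \<in> hom C A A'; g \<in> hom C B B'\<rbrakk>
        \<Longrightarrow> symmetry C A' B' \<cdot> (f \<otimes> g) = (g \<otimes> f) \<cdot> symmetry C A B"
    and symmetry_symmetry:
      "\<lbrakk>A \<in> obj C; B \<in> obj C\<rbrakk> \<Longrightarrow> symmetry C B A \<cdot> symmetry C A B = ident C (A \<odot> B)"
    and symmetry_unit:
      "A \<in> obj C \<Longrightarrow> left_unitor C A \<cdot> symmetry C A \<one> = right_unitor C A"
    and hexagon:
      "\<lbrakk>A \<in> obj C; B \<in> obj C; D \<in> obj C\<rbrakk>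
        \<Longrightarrow> associator C B D A \<cdot> symmetry C A (B \<odot> D) \<cdot> associator C A B D
            = (ident C B \<otimes> symmetry C A D) \<cdot> associator C B A D
                \<cdot> (symmetry C A B \<otimes> ident C D)"

locale dagger_symmetric_monoidal_category = dagger_category + symmetric_monoidal_category +
  assumes dagger_tensor:
      "\<lbrakk>f \<in> hom C A B; g \<in> hom C A' B'\<rbrakk> \<Longrightarrow> (f \<otimes> g)\<^sup>\<dagger> = f\<^sup>\<dagger> \<otimes> g\<^sup>\<dagger>"
    and associator_unitary:
      "\<lbrakk>A \<in> obj C; B \<in> obj C; D \<in> obj C\<rbrakk>
        \<Longrightarrow> unitary C ((A \<odot> B) \<odot> D) (A \<odot> (B \<odot> D)) (associator C A B D)"
    and left_unitor_unitary: "A \<in> obj C \<Longrightarrow> unitary C (\<one> \<odot> A) A (left_unitor C A)"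
    and right_unitor_unitary: "A \<in> obj C \<Longrightarrow> unitary C (A \<odot> \<one>) A (right_unitor C A)"
    and symmetry_unitary:
      "\<lbrakk>A \<in> obj C; B \<in> obj C\<rbrakk> \<Longrightarrow> unitary C (A \<odot> B) (B \<odot> A) (symmetry C A B)"

definition cap :: "('o, 'a, 'z) compact_dagger_data_scheme \<Rightarrow> 'o \<Rightarrow> 'a" where
  "cap C A = (cup C A)\<^sup>\<dagger>\<^bsub>C\<^esub> \<cdot>\<^bsub>C\<^esub> symmetry C A (A\<^sup>\<star>\<^bsub>C\<^esub>)"

text \<open>
  Coherence isomorphisms are written out explicitly from here on; since they are unitary, their
  inverses are their daggers.

  The conventions \<open>A** = A\<close>, \<open>(A \<otimes> B)* = B* \<otimes> A*\<close> and \<open>I* = I\<close> identify duals along the canonical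
  isomorphisms. As the conjugate of a morphism depends on the chosen cups and not only on the dual
  objects, this means that the cups correspond as well: \<open>u\<^sub>A\<^sub>*\<close> is the flipped \<open>u\<^sub>A\<close>, the cup of
  \<open>A \<otimes> B\<close> is the cup of \<open>A\<close> nested inside the cup of \<open>B\<close>, and the cup of \<open>I\<close> is the canonical
  isomorphism \<open>I \<rightarrow> I \<otimes> I\<close>.
\<close>

locale compact_dagger_category = dagger_symmetric_monoidal_category +
  assumes dual_obj: "A \<in> obj C \<Longrightarrow> A\<^sup>\<star> \<in> obj C"
    and cup_hom: "A \<in> obj C \<Longrightarrow> cup C A \<in> hom C \<one> (A\<^sup>\<star> \<odot> A)"
    and snake_obj:
      "A \<in> obj C \<Longrightarrow>
        left_unitor C A \<cdot> (cap C A \<otimes> ident C A) \<cdot> (associator C A (A\<^sup>\<star>) A)\<^sup>\<dagger>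
          \<cdot> (ident C A \<otimes> cup C A) \<cdot> (right_unitor C A)\<^sup>\<dagger> = ident C A"
    and snake_dual:
      "A \<in> obj C \<Longrightarrow>
        right_unitor C (A\<^sup>\<star>) \<cdot> (ident C (A\<^sup>\<star>) \<otimes> cap C A) \<cdot> associator C (A\<^sup>\<star>) A (A\<^sup>\<star>)
          \<cdot> (cup C A \<otimes> ident C (A\<^sup>\<star>)) \<cdot> (left_unitor C (A\<^sup>\<star>))\<^sup>\<dagger> = ident C (A\<^sup>\<star>)"
    and dual_dual: "A \<in> obj C \<Longrightarrow> (A\<^sup>\<star>)\<^sup>\<star> = A"
    and dual_tensor: "\<lbrakk>A \<in> obj C; B \<in> obj C\<rbrakk> \<Longrightarrow> (A \<odot> B)\<^sup>\<star> = B\<^sup>\<star> \<odot> A\<^sup>\<star>"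
    and dual_unit: "\<one>\<^sup>\<star> = \<one>"
    and cup_dual: "A \<in> obj C \<Longrightarrow> cup C (A\<^sup>\<star>) = symmetry C (A\<^sup>\<star>) A \<cdot> cup C A"
    and cup_tensor:
      "\<lbrakk>A \<in> obj C; B \<in> obj C\<rbrakk> \<Longrightarrow>
        cup C (A \<odot> B) =
          (associator C (B\<^sup>\<star>) (A\<^sup>\<star>) (A \<odot> B))\<^sup>\<dagger>
          \<cdot> (ident C (B\<^sup>\<star>) \<otimes> (associator C (A\<^sup>\<star>) A B \<cdot> (cup C A \<otimes> ident C B) \<cdot> (left_unitor C B)\<^sup>\<dagger>))
          \<cdot> cup C B"
    and cup_unit: "cup C \<one> = (left_unitor C \<one>)\<^sup>\<dagger>"

context
  fixes C :: "('o, 'a, 'z) compact_dagger_data_scheme" (structure)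
begin

text \<open>The conjugate \<open>f\<^sub>* : A* \<rightarrow> B*\<close> of \<open>f : A \<rightarrow> B\<close>, that is, the transpose of \<open>f\<^sup>\<dagger>\<close>.\<close>

definition conjugate :: "'o \<Rightarrow> 'o \<Rightarrow> 'a \<Rightarrow> 'a" where
  "conjugate A B f =
     right_unitor C (B\<^sup>\<star>) \<cdot> (ident C (B\<^sup>\<star>) \<otimes> cap C A) \<cdot> (ident C (B\<^sup>\<star>) \<otimes> (f\<^sup>\<dagger> \<otimes> ident C (A\<^sup>\<star>)))
     \<cdot> associator C (B\<^sup>\<star>) B (A\<^sup>\<star>) \<cdot> (cup C B \<otimes> ident C (A\<^sup>\<star>)) \<cdot> (left_unitor C (A\<^sup>\<star>))\<^sup>\<dagger>"

definition monoid_in :: "'o \<Rightarrow> 'a \<Rightarrow> 'a \<Rightarrow> bool" where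
  "monoid_in A m e \<longleftrightarrow>
     A \<in> obj C \<and> m \<in> hom C (A \<odot> A) A \<and> e \<in> hom C \<one> A \<and>
     m \<cdot> (m \<otimes> ident C A) = m \<cdot> (ident C A \<otimes> m) \<cdot> associator C A A A \<and>
     m \<cdot> (e \<otimes> ident C A) = left_unitor C A \<and>
     m \<cdot> (ident C A \<otimes> e) = right_unitor C A"

definition monoid_hom :: "'o \<Rightarrow> 'a \<Rightarrow> 'a \<Rightarrow> 'o \<Rightarrow> 'a \<Rightarrow> 'a \<Rightarrow> 'a \<Rightarrow> bool" where
  "monoid_hom A m e B n k f \<longleftrightarrow>
     f \<in> hom C A B \<and> f \<cdot> m = n \<cdot> (f \<otimes> f) \<and> f \<cdot> e = k"

definition frobenius_monoid :: "'o \<Rightarrow> 'a \<Rightarrow> 'a \<Rightarrow> bool" where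
  "frobenius_monoid A m e \<longleftrightarrow>
     monoid_in A m e \<and>
     (ident C A \<otimes> m) \<cdot> associator C A A A \<cdot> (m\<^sup>\<dagger> \<otimes> ident C A)
       = (m \<otimes> ident C A) \<cdot> (associator C A A A)\<^sup>\<dagger> \<cdot> (ident C A \<otimes> m\<^sup>\<dagger>)"

text \<open>
  The opposite monoid on \<open>A*\<close> is well typed because \<open>(A \<otimes> A)* = A* \<otimes> A*\<close> and \<open>I* = I\<close>.
\<close>

definition op_mult :: "'o \<Rightarrow> 'a \<Rightarrow> 'a" where
  "op_mult A m = conjugate (A \<odot> A) A m"

definition op_unit :: "'o \<Rightarrow> 'a \<Rightarrow> 'a" where
  "op_unit A e = conjugate \<one> A e"

definition involutive_monoid :: "'o \<Rightarrow> 'a \<Rightarrow> 'a \<Rightarrow> 'a \<Rightarrow> bool" where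
  "involutive_monoid A m e i \<longleftrightarrow>
     monoid_in A m e \<and>
     monoid_hom A m e (A\<^sup>\<star>) (op_mult A m) (op_unit A e) i \<and>
     conjugate A (A\<^sup>\<star>) i \<cdot> i = ident C A"

definition involutive_monoid_hom ::
  "'o \<Rightarrow> 'a \<Rightarrow> 'a \<Rightarrow> 'a \<Rightarrow> 'o \<Rightarrow> 'a \<Rightarrow> 'a \<Rightarrow> 'a \<Rightarrow> 'a \<Rightarrow> bool" where
  "involutive_monoid_hom A m e i B n k j f \<longleftrightarrow>
     monoid_hom A m e B n k f \<and> j \<cdot> f = conjugate A B f \<cdot> i"

definition pants_mult :: "'o \<Rightarrow> 'a" where
  "pants_mult A =
     (ident C (A\<^sup>\<star>) \<otimes> (left_unitor C A \<cdot> (cap C A \<otimes> ident C A) \<cdot> (associator C A (A\<^sup>\<star>) A)\<^sup>\<dagger>))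
     \<cdot> associator C (A\<^sup>\<star>) A (A\<^sup>\<star> \<odot> A)"

definition pants_unit :: "'o \<Rightarrow> 'a" where
  "pants_unit A = cup C A"

definition induced_involution :: "'o \<Rightarrow> 'a \<Rightarrow> 'a \<Rightarrow> 'a" where
  "induced_involution A m e =
     right_unitor C (A\<^sup>\<star>) \<cdot> (ident C (A\<^sup>\<star>) \<otimes> (e\<^sup>\<dagger> \<cdot> m)) \<cdot> associator C (A\<^sup>\<star>) A A
     \<cdot> (cup C A \<otimes> ident C A) \<cdot> (left_unitor C A)\<^sup>\<dagger>"

definition cayley_embedding :: "'o \<Rightarrow> 'a \<Rightarrow> 'a" where
  "cayley_embedding A m =
     (ident C (A\<^sup>\<star>) \<otimes> m) \<cdot> associator C (A\<^sup>\<star>) A A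
     \<cdot> (cup C A \<otimes> ident C A) \<cdot> (left_unitor C A)\<^sup>\<dagger>"

end

end

theory Submission
  imports Defs
begin

text \<open>
  Put \<open>p = e\<^sup>\<dagger> \<circ> m\<close> and \<open>q = (id \<otimes> p) \<circ> (m\<^sup>\<dagger> \<otimes> id) : A \<otimes> A \<rightarrow> A\<close>. Both sides of the equivalence
  amount to \<open>m = q\<close>.

  The Frobenius law followed by \<open>id \<otimes> e\<^sup>\<dagger>\<close> is \<open>q = m\<close>. Conversely, \<open>m = q\<close> precomposed with
  \<open>e \<otimes> id\<close> gives the snake equation \<open>(id \<otimes> p) \<circ> (p\<^sup>\<dagger> \<otimes> id) = id\<close>; with associativity it yields the
  mirror image \<open>m\<^sup>\<dagger> = (id \<otimes> m) \<circ> (p\<^sup>\<dagger> \<otimes> id)\<close> of the dagger of \<open>m = q\<close>, and the Frobenius law follows.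

  By naturality of bending, \<open>R\<close> is always a monoid homomorphism and \<open>R\<^sub>* \<circ> i\<close> is \<open>q\<close> with its first
  input bent, just as \<open>R\<close> is \<open>m\<close> with its first input bent. So \<open>R = R\<^sub>* \<circ> i\<close> means \<open>m = q\<close>.
  Finally \<open>m = q\<close> makes \<open>i\<close> an involution: \<open>i\<^sub>* \<circ> i\<close> is the snake of \<open>p\<close>, and preservation of
  multiplication unbends to \<open>p \<circ> (id \<otimes> m) = p \<circ> (q \<otimes> id)\<close>.
\<close>

section \<open>Typed composition\<close>

text \<open>Recovering source and target of an arrow as functions turns all typing side conditions into
  equations between objects, which the simplifier decides.\<close>

context category
begin

definition arr :: "'a \<Rightarrow> bool" where
  "arr f \<longleftrightarrow> (\<exists>A B. f \<in> hom C A B)"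

definition src :: "'a \<Rightarrow> 'o" where
  "src f = (THE A. \<exists>B. f \<in> hom C A B)"

definition tgt :: "'a \<Rightarrow> 'o" where
  "tgt f = (THE B. \<exists>A. f \<in> hom C A B)"

abbreviation \<iota> where
  "\<iota> \<equiv> ident C"

text \<open>Disjointness of hom-sets makes both definite descriptions unique on arrows.\<close>

lemma in_hom_iff: "f \<in> hom C A B \<longleftrightarrow> arr f \<and> src f = A \<and> tgt f = B"
proof -
  have *: "arr f \<and> src f = A \<and> tgt f = B" if "f \<in> hom C A B" for A B
  proof -
    have "src f = A" unfolding src_def
      by (rule the_equality) (use that hom_disjoint in blast)+
    moreover have "tgt f = B" unfolding tgt_def
      by (rule the_equality) (use that hom_disjoint in blast)+
    ultimately show ?thesis using that arr_def by blast
  qed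
  show ?thesis
  proof
    assume "arr f \<and> src f = A \<and> tgt f = B"
    then obtain A' B' where "f \<in> hom C A' B'" "src f = A" "tgt f = B"
      unfolding arr_def by blast
    then show "f \<in> hom C A B" using *[of A' B'] by simp
  qed (rule *)
qed

lemma src_obj [simp]: "arr f \<Longrightarrow> src f \<in> obj C"
  and tgt_obj [simp]: "arr f \<Longrightarrow> tgt f \<in> obj C"
  using hom_obj[of f "src f" "tgt f"] by (simp_all add: in_hom_iff)

lemma arr_ident [simp]: "A \<in> obj C \<Longrightarrow> arr (\<iota> A)"
  and src_ident [simp]: "A \<in> obj C \<Longrightarrow> src (\<iota> A) = A"
  and tgt_ident [simp]: "A \<in> obj C \<Longrightarrow> tgt (\<iota> A) = A"
  using ident_hom[of A] by (simp_all add: in_hom_iff)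

lemma arr_comp [simp]: "\<lbrakk>arr f; arr g; src g = tgt f\<rbrakk> \<Longrightarrow> arr (g \<cdot> f)"
  and src_comp [simp]: "\<lbrakk>arr f; arr g; src g = tgt f\<rbrakk> \<Longrightarrow> src (g \<cdot> f) = src f"
  and tgt_comp [simp]: "\<lbrakk>arr f; arr g; src g = tgt f\<rbrakk> \<Longrightarrow> tgt (g \<cdot> f) = tgt g"
  using comp_hom[of f "src f" "tgt f" g "tgt g"] by (simp_all add: in_hom_iff)

lemma ident_comp [simp]: "\<lbrakk>arr f; tgt f = A\<rbrakk> \<Longrightarrow> \<iota> A \<cdot> f = f"
  and comp_ident [simp]: "\<lbrakk>arr f; src f = A\<rbrakk> \<Longrightarrow> f \<cdot> \<iota> A = f"
  using ident_left[of f "src f" "tgt f"] ident_right[of f "src f" "tgt f"]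
  by (auto simp: in_hom_iff)

lemma comp_comp [simp]:
  "\<lbrakk>arr f; arr g; arr h; src g = tgt f; src h = tgt g\<rbrakk> \<Longrightarrow> (h \<cdot> g) \<cdot> f = h \<cdot> g \<cdot> f"
  using comp_assoc[of f "src f" "tgt f" g "tgt g" h "tgt h"] by (simp add: in_hom_iff)

text \<open>Composites are normalised to the right, so an equation for \<open>g \<cdot> f\<close> no
  longer matches once further factors follow. This rule supplies its version with a tail
  \<open>x\<close>.\<close>

lemma eq_compD:
  assumes "g \<cdot> f = k" and "arr f" "arr g" "arr x" "src g = tgt f" "src f = tgt x"
  shows "g \<cdot> f \<cdot> x = k \<cdot> x"
  using comp_comp[of x f g] assms by simp

lemma comp_right_cong: "f = g \<Longrightarrow> f \<cdot> x = g \<cdot> x"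
  and comp_left_cong: "f = g \<Longrightarrow> x \<cdot> f = x \<cdot> g"
  by simp_all

text \<open>The same for three leading factors, as on the left of the pentagon.\<close>

lemma eq_compD3:
  assumes "h \<cdot> g \<cdot> f = k" and "arr f" "arr g" "arr h" "arr x"
    and "src h = tgt g" "src g = tgt f" "src f = tgt x"
  shows "h \<cdot> g \<cdot> f \<cdot> x = k \<cdot> x"
  using comp_comp[of x "g \<cdot> f" h] comp_comp[of x f g] assms by simp

end

context dagger_category
begin

lemma arr_dagger [simp]: "arr f \<Longrightarrow> arr (f\<^sup>\<dagger>)"
  and src_dagger [simp]: "arr f \<Longrightarrow> src (f\<^sup>\<dagger>) = tgt f"
  and tgt_dagger [simp]: "arr f \<Longrightarrow> tgt (f\<^sup>\<dagger>) = src f"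
  using dagger_hom[of f "src f" "tgt f"] by (simp_all add: in_hom_iff)

lemma dagger_dagger' [simp]: "arr f \<Longrightarrow> (f\<^sup>\<dagger>)\<^sup>\<dagger> = f"
  using dagger_dagger[of f "src f" "tgt f"] by (simp add: in_hom_iff)

lemma dagger_comp' [simp]: "\<lbrakk>arr f; arr g; src g = tgt f\<rbrakk> \<Longrightarrow> (g \<cdot> f)\<^sup>\<dagger> = f\<^sup>\<dagger> \<cdot> g\<^sup>\<dagger>"
  using dagger_comp[of f "src f" "tgt f" g "tgt g"] by (simp add: in_hom_iff)

declare dagger_ident [simp]

lemma dagger_eqD: "f = g \<Longrightarrow> f\<^sup>\<dagger> = g\<^sup>\<dagger>"
  by simp

end

section \<open>Coherence\<close>

context dagger_symmetric_monoidal_category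
begin

abbreviation \<alpha> where
  "\<alpha> \<equiv> associator C"

abbreviation \<l> where
  "\<l> \<equiv> left_unitor C"

abbreviation \<r> where
  "\<r> \<equiv> right_unitor C"

declare unit_obj [simp] tensor_obj [simp] tensor_ident [simp]

lemma arr_tensor [simp]: "\<lbrakk>arr f; arr g\<rbrakk> \<Longrightarrow> arr (f \<otimes> g)"
  and src_tensor [simp]: "\<lbrakk>arr f; arr g\<rbrakk> \<Longrightarrow> src (f \<otimes> g) = src f \<odot> src g"
  and tgt_tensor [simp]: "\<lbrakk>arr f; arr g\<rbrakk> \<Longrightarrow> tgt (f \<otimes> g) = tgt f \<odot> tgt g"
  using tensor_hom[of f "src f" "tgt f" g "src g" "tgt g"] by (simp_all add: in_hom_iff)

lemma dagger_tensor' [simp]: "\<lbrakk>arr f; arr g\<rbrakk> \<Longrightarrow> (f \<otimes> g)\<^sup>\<dagger> = f\<^sup>\<dagger> \<otimes> g\<^sup>\<dagger>"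
  using dagger_tensor[of f "src f" "tgt f" g "src g" "tgt g"] by (simp add: in_hom_iff)

lemma interchange:
  "\<lbrakk>arr f; arr g; arr f'; arr g'; src g = tgt f; src g' = tgt f'\<rbrakk>
    \<Longrightarrow> (g \<otimes> g') \<cdot> (f \<otimes> f') = (g \<cdot> f) \<otimes> (g' \<cdot> f')"
  using tensor_comp[of f "src f" "tgt f" g "tgt g" f' "src f'" "tgt f'" g' "tgt g'"]
  by (simp add: in_hom_iff)

text \<open>The interchange law is oriented to merge adjacent tensor layers, at the end of a
  composite or before a tail. Diagrams that differ by sliding boxes along parallel wires are
  compared this way.\<close>

lemmas fuse = interchange interchange[THEN eq_compD]

lemma arr_associator [simp]:
    "\<lbrakk>A \<in> obj C; B \<in> obj C; D \<in> obj C\<rbrakk> \<Longrightarrow> arr (\<alpha> A B D)"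
  and src_associator [simp]:
    "\<lbrakk>A \<in> obj C; B \<in> obj C; D \<in> obj C\<rbrakk> \<Longrightarrow> src (\<alpha> A B D) = (A \<odot> B) \<odot> D"
  and tgt_associator [simp]:
    "\<lbrakk>A \<in> obj C; B \<in> obj C; D \<in> obj C\<rbrakk> \<Longrightarrow> tgt (\<alpha> A B D) = A \<odot> (B \<odot> D)"
  and associator_dagger_left [simp]:
    "\<lbrakk>A \<in> obj C; B \<in> obj C; D \<in> obj C\<rbrakk> \<Longrightarrow> (\<alpha> A B D)\<^sup>\<dagger> \<cdot> \<alpha> A B D = \<iota> ((A \<odot> B) \<odot> D)"
  and associator_dagger_right [simp]:
    "\<lbrakk>A \<in> obj C; B \<in> obj C; D \<in> obj C\<rbrakk> \<Longrightarrow> \<alpha> A B D \<cdot> (\<alpha> A B D)\<^sup>\<dagger> = \<iota> (A \<odot> (B \<odot> D))"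
  using associator_unitary[of A B D] by (simp_all add: unitary_def in_hom_iff)

lemma arr_left_unitor [simp]: "A \<in> obj C \<Longrightarrow> arr (\<l> A)"
  and src_left_unitor [simp]: "A \<in> obj C \<Longrightarrow> src (\<l> A) = \<one> \<odot> A"
  and tgt_left_unitor [simp]: "A \<in> obj C \<Longrightarrow> tgt (\<l> A) = A"
  and left_unitor_dagger_left [simp]: "A \<in> obj C \<Longrightarrow> (\<l> A)\<^sup>\<dagger> \<cdot> \<l> A = \<iota> (\<one> \<odot> A)"
  and left_unitor_dagger_right [simp]: "A \<in> obj C \<Longrightarrow> \<l> A \<cdot> (\<l> A)\<^sup>\<dagger> = \<iota> A"
  using left_unitor_unitary[of A] by (simp_all add: unitary_def in_hom_iff)

lemma arr_right_unitor [simp]: "A \<in> obj C \<Longrightarrow> arr (\<r> A)"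
  and src_right_unitor [simp]: "A \<in> obj C \<Longrightarrow> src (\<r> A) = A \<odot> \<one>"
  and tgt_right_unitor [simp]: "A \<in> obj C \<Longrightarrow> tgt (\<r> A) = A"
  and right_unitor_dagger_left [simp]: "A \<in> obj C \<Longrightarrow> (\<r> A)\<^sup>\<dagger> \<cdot> \<r> A = \<iota> (A \<odot> \<one>)"
  and right_unitor_dagger_right [simp]: "A \<in> obj C \<Longrightarrow> \<r> A \<cdot> (\<r> A)\<^sup>\<dagger> = \<iota> A"
  using right_unitor_unitary[of A] by (simp_all add: unitary_def in_hom_iff)

lemmas unitary_comp [simp] =
  associator_dagger_left[THEN eq_compD] associator_dagger_right[THEN eq_compD]
  left_unitor_dagger_left[THEN eq_compD] left_unitor_dagger_right[THEN eq_compD]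
  right_unitor_dagger_left[THEN eq_compD] right_unitor_dagger_right[THEN eq_compD]

section \<open>Naturality of the coherence isomorphisms and of their inverses\<close>

lemma associator_nat:
  "\<lbrakk>arr f; arr g; arr h; A = tgt f; B = tgt g; D = tgt h\<rbrakk>
    \<Longrightarrow> \<alpha> A B D \<cdot> ((f \<otimes> g) \<otimes> h) = (f \<otimes> (g \<otimes> h)) \<cdot> \<alpha> (src f) (src g) (src h)"
  using associator_natural[of f "src f" "tgt f" g "src g" "tgt g" h "src h" "tgt h"]
  by (simp add: in_hom_iff)

text \<open>The simplifier merges \<open>\<iota> A \<otimes> \<iota> B\<close> into
  \<open>\<iota> (A \<odot> B)\<close>, a form that the general naturality rule does not
  match.\<close>

lemma associator_nat_ident:
  assumes "arr h" "A \<in> obj C" "B \<in> obj C" "D = tgt h"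
  shows "\<alpha> A B D \<cdot> (\<iota> (A \<odot> B) \<otimes> h) = (\<iota> A \<otimes> (\<iota> B \<otimes> h)) \<cdot> \<alpha> A B (src h)"
  using associator_nat[of "\<iota> A" "\<iota> B" h A B D] assms by simp

text \<open>The dagger of the associator is its inverse, so the dagger of a naturality square at
  daggered morphisms is a naturality square of the inverse.\<close>

lemma dagger_associator_nat:
  assumes "arr f" "arr g" "arr h" "A = tgt f" "B = tgt g" "D = tgt h"
  shows "(\<alpha> A B D)\<^sup>\<dagger> \<cdot> (f \<otimes> (g \<otimes> h)) = ((f \<otimes> g) \<otimes> h) \<cdot> (\<alpha> (src f) (src g) (src h))\<^sup>\<dagger>"
  using associator_nat[of "f\<^sup>\<dagger>" "g\<^sup>\<dagger>" "h\<^sup>\<dagger>", OF _ _ _ refl refl refl, THEN dagger_eqD] assms by simp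

lemma dagger_associator_nat_ident:
  assumes "arr f" "B \<in> obj C" "D \<in> obj C" "A = tgt f"
  shows "(\<alpha> A B D)\<^sup>\<dagger> \<cdot> (f \<otimes> \<iota> (B \<odot> D)) = ((f \<otimes> \<iota> B) \<otimes> \<iota> D) \<cdot> (\<alpha> (src f) B D)\<^sup>\<dagger>"
  using dagger_associator_nat[of f "\<iota> B" "\<iota> D" A B D] assms by simp

lemma left_unitor_nat:
  "\<lbrakk>arr f; A = tgt f\<rbrakk> \<Longrightarrow> \<l> A \<cdot> (\<iota> \<one> \<otimes> f) = f \<cdot> \<l> (src f)"
  using left_unitor_natural[of f "src f" "tgt f"] by (simp add: in_hom_iff)

lemma right_unitor_nat:
  "\<lbrakk>arr f; A = tgt f\<rbrakk> \<Longrightarrow> \<r> A \<cdot> (f \<otimes> \<iota> \<one>) = f \<cdot> \<r> (src f)"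
  using right_unitor_natural[of f "src f" "tgt f"] by (simp add: in_hom_iff)

lemma dagger_left_unitor_nat:
  assumes "arr f" "A = tgt f"
  shows "(\<l> A)\<^sup>\<dagger> \<cdot> f = (\<iota> \<one> \<otimes> f) \<cdot> (\<l> (src f))\<^sup>\<dagger>"
  using left_unitor_nat[of "f\<^sup>\<dagger>", OF _ refl, THEN dagger_eqD] assms by simp

lemma dagger_right_unitor_nat:
  assumes "arr f" "A = tgt f"
  shows "(\<r> A)\<^sup>\<dagger> \<cdot> f = (f \<otimes> \<iota> \<one>) \<cdot> (\<r> (src f))\<^sup>\<dagger>"
  using right_unitor_nat[of "f\<^sup>\<dagger>", OF _ refl, THEN dagger_eqD] assms by simp

section \<open>Unitors of tensor products and of the unit object\<close>

text \<open>By naturality, the left unitor identifies \<open>\<iota> \<one> \<otimes> f\<close> with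
  \<open>f\<close> up to isomorphism, so tensoring with the unit object is faithful.\<close>

lemma unit_tensor_cancel:
  assumes "arr f" "arr g" "src f = src g" "tgt f = tgt g" "\<iota> \<one> \<otimes> f = \<iota> \<one> \<otimes> g"
  shows "f = g"
proof -
  have "f \<cdot> \<l> (src f) = g \<cdot> \<l> (src f)"
    using left_unitor_nat[of f "tgt f"] left_unitor_nat[of g "tgt g"] assms by simp
  then have "(f \<cdot> \<l> (src f)) \<cdot> (\<l> (src f))\<^sup>\<dagger> = (g \<cdot> \<l> (src f)) \<cdot> (\<l> (src f))\<^sup>\<dagger>"
    by (rule comp_right_cong)
  then show ?thesis using assms by simp
qed

lemma tensor_unit_cancel:
  assumes "arr f" "arr g" "src f = src g" "tgt f = tgt g" "f \<otimes> \<iota> \<one> = g \<otimes> \<iota> \<one>"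
  shows "f = g"
proof -
  have "f \<cdot> \<r> (src f) = g \<cdot> \<r> (src f)"
    using right_unitor_nat[of f "tgt f"] right_unitor_nat[of g "tgt g"] assms by simp
  then have "(f \<cdot> \<r> (src f)) \<cdot> (\<r> (src f))\<^sup>\<dagger> = (g \<cdot> \<r> (src f)) \<cdot> (\<r> (src f))\<^sup>\<dagger>"
    by (rule comp_right_cong)
  then show ?thesis using assms by simp
qed

text \<open>Kelly's argument: after tensoring with the unit on the left, the pentagon, two triangles
  and naturality of the associator connect both sides.\<close>

lemma left_unitor_tensor:
  assumes [simp]: "A \<in> obj C" "B \<in> obj C"
  shows "\<l> (A \<odot> B) \<cdot> \<alpha> \<one> A B = \<l> A \<otimes> \<iota> B"
proof (rule unit_tensor_cancel)
  let ?w = "\<alpha> \<one> (\<one> \<odot> A) B \<cdot> (\<alpha> \<one> \<one> A \<otimes> \<iota> B)"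
  have "(\<iota> \<one> \<otimes> (\<l> (A \<odot> B) \<cdot> \<alpha> \<one> A B)) \<cdot> ?w
      = (\<iota> \<one> \<otimes> \<l> (A \<odot> B)) \<cdot> (\<iota> \<one> \<otimes> \<alpha> \<one> A B) \<cdot> ?w"
    by (simp add: fuse)
  also have "\<dots> = (\<iota> \<one> \<otimes> \<l> (A \<odot> B)) \<cdot> \<alpha> \<one> \<one> (A \<odot> B) \<cdot> \<alpha> (\<one> \<odot> \<one>) A B"
    by (simp add: pentagon)
  also have "\<dots> = (\<r> \<one> \<otimes> \<iota> (A \<odot> B)) \<cdot> \<alpha> (\<one> \<odot> \<one>) A B"
    by (simp add: triangle[THEN eq_compD])
  also have "\<dots> = \<alpha> \<one> A B \<cdot> ((\<r> \<one> \<otimes> \<iota> A) \<otimes> \<iota> B)"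
    by (simp add: associator_nat)
  also have "\<dots> = \<alpha> \<one> A B \<cdot> ((\<iota> \<one> \<otimes> \<l> A) \<otimes> \<iota> B) \<cdot> (\<alpha> \<one> \<one> A \<otimes> \<iota> B)"
    by (simp add: fuse triangle)
  also have "\<dots> = (\<iota> \<one> \<otimes> (\<l> A \<otimes> \<iota> B)) \<cdot> ?w"
    by (simp add: associator_nat[THEN eq_compD])
  \<comment> \<open>Composing with the inverse of \<open>?w\<close> cancels it on the right.\<close>
  finally have "((\<iota> \<one> \<otimes> (\<l> (A \<odot> B) \<cdot> \<alpha> \<one> A B)) \<cdot> ?w) \<cdot> ((\<alpha> \<one> \<one> A)\<^sup>\<dagger> \<otimes> \<iota> B) \<cdot> (\<alpha> \<one> (\<one> \<odot> A) B)\<^sup>\<dagger>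
      = ((\<iota> \<one> \<otimes> (\<l> A \<otimes> \<iota> B)) \<cdot> ?w) \<cdot> ((\<alpha> \<one> \<one> A)\<^sup>\<dagger> \<otimes> \<iota> B) \<cdot> (\<alpha> \<one> (\<one> \<odot> A) B)\<^sup>\<dagger>"
    by (rule comp_right_cong)
  then show "\<iota> \<one> \<otimes> (\<l> (A \<odot> B) \<cdot> \<alpha> \<one> A B) = \<iota> \<one> \<otimes> (\<l> A \<otimes> \<iota> B)"
    by (simp add: fuse)
qed simp_all

text \<open>The mirror argument, with the unit on the right and a postcomposed associator that is
  cancelled at the end.\<close>

lemma right_unitor_tensor:
  assumes [simp]: "A \<in> obj C" "B \<in> obj C"
  shows "(\<iota> A \<otimes> \<r> B) \<cdot> \<alpha> A B \<one> = \<r> (A \<odot> B)"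
proof (rule tensor_unit_cancel)
  have "\<alpha> A B \<one> \<cdot> (((\<iota> A \<otimes> \<r> B) \<cdot> \<alpha> A B \<one>) \<otimes> \<iota> \<one>)
      = \<alpha> A B \<one> \<cdot> ((\<iota> A \<otimes> \<r> B) \<otimes> \<iota> \<one>) \<cdot> (\<alpha> A B \<one> \<otimes> \<iota> \<one>)"
    by (simp add: fuse)
  also have "\<dots> = (\<iota> A \<otimes> (\<r> B \<otimes> \<iota> \<one>)) \<cdot> \<alpha> A (B \<odot> \<one>) \<one> \<cdot> (\<alpha> A B \<one> \<otimes> \<iota> \<one>)"
    by (simp add: associator_nat[THEN eq_compD])
  also have "\<dots> = (\<iota> A \<otimes> (\<iota> B \<otimes> \<l> \<one>)) \<cdot> (\<iota> A \<otimes> \<alpha> B \<one> \<one>) \<cdot> \<alpha> A (B \<odot> \<one>) \<one> \<cdot> (\<alpha> A B \<one> \<otimes> \<iota> \<one>)"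
    by (simp add: fuse triangle)
  also have "\<dots> = (\<iota> A \<otimes> (\<iota> B \<otimes> \<l> \<one>)) \<cdot> \<alpha> A B (\<one> \<odot> \<one>) \<cdot> \<alpha> (A \<odot> B) \<one> \<one>"
    by (simp add: pentagon)
  also have "\<dots> = \<alpha> A B \<one> \<cdot> (\<iota> (A \<odot> B) \<otimes> \<l> \<one>) \<cdot> \<alpha> (A \<odot> B) \<one> \<one>"
    by (simp add: associator_nat_ident[THEN eq_compD])
  also have "\<dots> = \<alpha> A B \<one> \<cdot> (\<r> (A \<odot> B) \<otimes> \<iota> \<one>)"
    by (simp add: triangle)
  finally have "(\<alpha> A B \<one>)\<^sup>\<dagger> \<cdot> \<alpha> A B \<one> \<cdot> (((\<iota> A \<otimes> \<r> B) \<cdot> \<alpha> A B \<one>) \<otimes> \<iota> \<one>)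
      = (\<alpha> A B \<one>)\<^sup>\<dagger> \<cdot> \<alpha> A B \<one> \<cdot> (\<r> (A \<odot> B) \<otimes> \<iota> \<one>)"
    by (rule comp_left_cong)
  then show "((\<iota> A \<otimes> \<r> B) \<cdot> \<alpha> A B \<one>) \<otimes> \<iota> \<one> = \<r> (A \<odot> B) \<otimes> \<iota> \<one>"
    by simp
qed simp_all

lemma unitor_unit_eq: "\<l> \<one> = \<r> \<one>"
proof (rule tensor_unit_cancel)
  \<comment> \<open>Naturality of the left unitor is applied to the left unitor itself. The result
    gives \<open>left_unitor_tensor\<close> and the triangle at \<open>\<one>\<close> the same left
    side.\<close>
  have "(\<l> \<one>)\<^sup>\<dagger> \<cdot> \<l> \<one> \<cdot> (\<iota> \<one> \<otimes> \<l> \<one>) = (\<l> \<one>)\<^sup>\<dagger> \<cdot> \<l> \<one> \<cdot> \<l> (\<one> \<odot> \<one>)"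
    using left_unitor_nat[of "\<l> \<one>" \<one>] by simp
  then have "\<l> (\<one> \<odot> \<one>) = \<iota> \<one> \<otimes> \<l> \<one>"
    by simp
  then show "\<l> \<one> \<otimes> \<iota> \<one> = \<r> \<one> \<otimes> \<iota> \<one>"
    using left_unitor_tensor[of \<one> \<one>] triangle[of \<one> \<one>] by simp
qed simp_all

lemma dagger_left_unitor_tensor:
  assumes [simp]: "A \<in> obj C" "B \<in> obj C"
  shows "\<alpha> \<one> A B \<cdot> ((\<l> A)\<^sup>\<dagger> \<otimes> \<iota> B) = (\<l> (A \<odot> B))\<^sup>\<dagger>"
proof -
  have "(\<l> A)\<^sup>\<dagger> \<otimes> \<iota> B = (\<alpha> \<one> A B)\<^sup>\<dagger> \<cdot> (\<l> (A \<odot> B))\<^sup>\<dagger>"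
    using left_unitor_tensor[of A B, THEN dagger_eqD] by simp
  then show ?thesis by simp
qed

lemma dagger_right_unitor_tensor:
  assumes [simp]: "A \<in> obj C" "B \<in> obj C"
  shows "(\<alpha> A B \<one>)\<^sup>\<dagger> \<cdot> (\<iota> A \<otimes> (\<r> B)\<^sup>\<dagger>) = (\<r> (A \<odot> B))\<^sup>\<dagger>"
  using right_unitor_tensor[of A B, THEN dagger_eqD] by simp

lemma dagger_triangle:
  assumes [simp]: "A \<in> obj C" "B \<in> obj C"
  shows "(\<alpha> A \<one> B)\<^sup>\<dagger> \<cdot> (\<iota> A \<otimes> (\<l> B)\<^sup>\<dagger>) = (\<r> A)\<^sup>\<dagger> \<otimes> \<iota> B"
  using triangle[of A B, THEN dagger_eqD] by simp

text \<open>The pentagon solved for an inverse associator followed by an associator on the other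
  side, the pattern found in snake composites.\<close>

lemma pentagon_mixed:
  assumes [simp]: "A \<in> obj C" "B \<in> obj C" "D \<in> obj C" "E \<in> obj C"
  shows "(\<alpha> A B (D \<odot> E))\<^sup>\<dagger> \<cdot> (\<iota> A \<otimes> \<alpha> B D E)
    = \<alpha> (A \<odot> B) D E \<cdot> ((\<alpha> A B D)\<^sup>\<dagger> \<otimes> \<iota> E) \<cdot> (\<alpha> A (B \<odot> D) E)\<^sup>\<dagger>"
proof -
  let ?v = "((\<alpha> A B D)\<^sup>\<dagger> \<otimes> \<iota> E) \<cdot> (\<alpha> A (B \<odot> D) E)\<^sup>\<dagger>"
  have "\<iota> A \<otimes> \<alpha> B D E
      = ((\<iota> A \<otimes> \<alpha> B D E) \<cdot> \<alpha> A (B \<odot> D) E \<cdot> (\<alpha> A B D \<otimes> \<iota> E)) \<cdot> ?v"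
    by (simp add: fuse)
  also have "\<dots> = \<alpha> A B (D \<odot> E) \<cdot> \<alpha> (A \<odot> B) D E \<cdot> ?v"
    unfolding pentagon[OF assms] by simp
  finally have "\<iota> A \<otimes> \<alpha> B D E = \<alpha> A B (D \<odot> E) \<cdot> \<alpha> (A \<odot> B) D E \<cdot> ?v" .
  then show ?thesis by simp
qed

lemma dagger_pentagon:
  assumes [simp]: "A \<in> obj C" "B \<in> obj C" "D \<in> obj C" "E \<in> obj C"
  shows "((\<alpha> A B D)\<^sup>\<dagger> \<otimes> \<iota> E) \<cdot> (\<alpha> A (B \<odot> D) E)\<^sup>\<dagger> \<cdot> (\<iota> A \<otimes> (\<alpha> B D E)\<^sup>\<dagger>)
    = (\<alpha> (A \<odot> B) D E)\<^sup>\<dagger> \<cdot> (\<alpha> A B (D \<odot> E))\<^sup>\<dagger>"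
  using pentagon[of A B D E, THEN dagger_eqD] by simp

end

section \<open>Bending wires\<close>

context compact_dagger_category
begin

declare dual_obj [simp] dual_dual [simp] dual_tensor [simp] dual_unit [simp]

section \<open>Symmetry, cups and caps under the dagger\<close>

lemma arr_symmetry [simp]: "\<lbrakk>A \<in> obj C; B \<in> obj C\<rbrakk> \<Longrightarrow> arr (symmetry C A B)"
  and src_symmetry [simp]: "\<lbrakk>A \<in> obj C; B \<in> obj C\<rbrakk> \<Longrightarrow> src (symmetry C A B) = A \<odot> B"
  and tgt_symmetry [simp]: "\<lbrakk>A \<in> obj C; B \<in> obj C\<rbrakk> \<Longrightarrow> tgt (symmetry C A B) = B \<odot> A"
  using symmetry_hom[of A B] by (simp_all add: in_hom_iff)

lemma arr_cup [simp]: "A \<in> obj C \<Longrightarrow> arr (cup C A)"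
  and src_cup [simp]: "A \<in> obj C \<Longrightarrow> src (cup C A) = \<one>"
  and tgt_cup [simp]: "A \<in> obj C \<Longrightarrow> tgt (cup C A) = A\<^sup>\<star> \<odot> A"
  using cup_hom[of A] by (simp_all add: in_hom_iff)

lemma arr_cap [simp]: "A \<in> obj C \<Longrightarrow> arr (cap C A)"
  and src_cap [simp]: "A \<in> obj C \<Longrightarrow> src (cap C A) = A \<odot> A\<^sup>\<star>"
  and tgt_cap [simp]: "A \<in> obj C \<Longrightarrow> tgt (cap C A) = \<one>"
  by (simp_all add: cap_def)

text \<open>Both sides are inverse to \<open>symmetry C A B\<close>, one by unitarity and the other
  by involutivity of the symmetry.\<close>

lemma dagger_symmetry:
  assumes [simp]: "A \<in> obj C" "B \<in> obj C"
  shows "(symmetry C A B)\<^sup>\<dagger> = symmetry C B A"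
proof -
  have "(symmetry C B A \<cdot> symmetry C A B) \<cdot> (symmetry C A B)\<^sup>\<dagger> = (symmetry C A B)\<^sup>\<dagger>"
    by (simp add: symmetry_symmetry del: comp_comp)
  moreover have "symmetry C A B \<cdot> (symmetry C A B)\<^sup>\<dagger> = \<iota> (B \<odot> A)"
    using symmetry_unitary[of A B] by (simp add: unitary_def)
  ultimately show ?thesis by simp
qed

text \<open>The convention that the cup of \<open>A\<^sup>\<star>\<close> is the flipped cup of
  \<open>A\<close> enters here. It lets the dagger exchange cups and caps at dual objects.\<close>

lemma dagger_cup_dual:
  assumes [simp]: "A \<in> obj C"
  shows "(cup C (A\<^sup>\<star>))\<^sup>\<dagger> = cap C A"
  by (simp add: cup_dual cap_def dagger_symmetry)

lemma dagger_cup: "A \<in> obj C \<Longrightarrow> (cup C A)\<^sup>\<dagger> = cap C (A\<^sup>\<star>)"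
  using dagger_cup_dual[of "A\<^sup>\<star>"] by simp

lemma cap_unit: "cap C \<one> = \<r> \<one>"
  by (simp add: cap_def cup_unit symmetry_unit)

text \<open>\<open>coev A\<close> and \<open>ev A\<close> are unit and counit of the adjunction between \<open>A \<otimes> -\<close> and \<open>A* \<otimes> -\<close>; they
  absorb the coherence isomorphisms of all bent diagrams below.\<close>

definition coev where
  "coev A X = \<alpha> (A\<^sup>\<star>) A X \<cdot> (cup C A \<otimes> \<iota> X) \<cdot> (\<l> X)\<^sup>\<dagger>"

definition ev where
  "ev A Y = \<l> Y \<cdot> (cap C A \<otimes> \<iota> Y) \<cdot> (\<alpha> A (A\<^sup>\<star>) Y)\<^sup>\<dagger>"

lemma arr_coev [simp]: "\<lbrakk>A \<in> obj C; X \<in> obj C\<rbrakk> \<Longrightarrow> arr (coev A X)"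
  and src_coev [simp]: "\<lbrakk>A \<in> obj C; X \<in> obj C\<rbrakk> \<Longrightarrow> src (coev A X) = X"
  and tgt_coev [simp]: "\<lbrakk>A \<in> obj C; X \<in> obj C\<rbrakk> \<Longrightarrow> tgt (coev A X) = A\<^sup>\<star> \<odot> (A \<odot> X)"
  by (simp_all add: coev_def)

lemma arr_ev [simp]: "\<lbrakk>A \<in> obj C; Y \<in> obj C\<rbrakk> \<Longrightarrow> arr (ev A Y)"
  and src_ev [simp]: "\<lbrakk>A \<in> obj C; Y \<in> obj C\<rbrakk> \<Longrightarrow> src (ev A Y) = A \<odot> (A\<^sup>\<star> \<odot> Y)"
  and tgt_ev [simp]: "\<lbrakk>A \<in> obj C; Y \<in> obj C\<rbrakk> \<Longrightarrow> tgt (ev A Y) = Y"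
  by (simp_all add: ev_def)

text \<open>The dagger exchanges the laws of \<open>coev\<close> and \<open>ev\<close> at dual
  objects, so in each mirror pair below one law is computed and the other is its dagger.\<close>

lemma dagger_coev: "\<lbrakk>A \<in> obj C; X \<in> obj C\<rbrakk> \<Longrightarrow> (coev A X)\<^sup>\<dagger> = ev (A\<^sup>\<star>) X"
  by (simp add: coev_def ev_def dagger_cup)

lemma dagger_ev: "\<lbrakk>A \<in> obj C; X \<in> obj C\<rbrakk> \<Longrightarrow> (ev A X)\<^sup>\<dagger> = coev (A\<^sup>\<star>) X"
  by (simp add: coev_def ev_def dagger_cup_dual[symmetric])

section \<open>Naturality and triangle identities of the adjunction\<close>

lemma coev_nat:
  assumes [simp]: "A \<in> obj C" "arr f" and "X = tgt f"
  shows "coev A X \<cdot> f = (\<iota> (A\<^sup>\<star>) \<otimes> (\<iota> A \<otimes> f)) \<cdot> coev A (src f)"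
proof -
  have "coev A X \<cdot> f = \<alpha> (A\<^sup>\<star>) A X \<cdot> (cup C A \<otimes> \<iota> X) \<cdot> (\<iota> \<one> \<otimes> f) \<cdot> (\<l> (src f))\<^sup>\<dagger>"
    using assms by (simp add: coev_def dagger_left_unitor_nat)
  also have "\<dots> = \<alpha> (A\<^sup>\<star>) A X \<cdot> (\<iota> (A\<^sup>\<star> \<odot> A) \<otimes> f) \<cdot> (cup C A \<otimes> \<iota> (src f)) \<cdot> (\<l> (src f))\<^sup>\<dagger>"
    using assms by (simp add: fuse)
  also have "\<dots> = (\<iota> (A\<^sup>\<star>) \<otimes> (\<iota> A \<otimes> f)) \<cdot> coev A (src f)"
    using assms by (simp add: coev_def associator_nat_ident[THEN eq_compD])
  finally show ?thesis .
qed

lemma ev_nat: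
  assumes [simp]: "A \<in> obj C" "arr f" and "Y = tgt f"
  shows "ev A Y \<cdot> (\<iota> A \<otimes> (\<iota> (A\<^sup>\<star>) \<otimes> f)) = f \<cdot> ev A (src f)"
  using coev_nat[of "A\<^sup>\<star>" "f\<^sup>\<dagger>", OF _ _ refl, THEN dagger_eqD] assms by (simp add: dagger_coev)

text \<open>The cup does not touch \<open>Y\<close>; the pentagon supplies the reassociation around
  it.\<close>

lemma coev_tensor:
  assumes [simp]: "A \<in> obj C" "X \<in> obj C" "Y \<in> obj C"
  shows "\<alpha> (A\<^sup>\<star>) (A \<odot> X) Y \<cdot> (coev A X \<otimes> \<iota> Y)
    = (\<iota> (A\<^sup>\<star>) \<otimes> (\<alpha> A X Y)\<^sup>\<dagger>) \<cdot> coev A (X \<odot> Y)"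
proof -
  have "(\<iota> (A\<^sup>\<star>) \<otimes> \<alpha> A X Y) \<cdot> \<alpha> (A\<^sup>\<star>) (A \<odot> X) Y \<cdot> (coev A X \<otimes> \<iota> Y)
      = (\<iota> (A\<^sup>\<star>) \<otimes> \<alpha> A X Y) \<cdot> \<alpha> (A\<^sup>\<star>) (A \<odot> X) Y \<cdot> (\<alpha> (A\<^sup>\<star>) A X \<otimes> \<iota> Y)
          \<cdot> ((cup C A \<otimes> \<iota> X) \<otimes> \<iota> Y) \<cdot> ((\<l> X)\<^sup>\<dagger> \<otimes> \<iota> Y)"
    by (simp add: coev_def fuse)
  also have "\<dots> = \<alpha> (A\<^sup>\<star>) A (X \<odot> Y) \<cdot> \<alpha> (A\<^sup>\<star> \<odot> A) X Y
          \<cdot> ((cup C A \<otimes> \<iota> X) \<otimes> \<iota> Y) \<cdot> ((\<l> X)\<^sup>\<dagger> \<otimes> \<iota> Y)"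
    by (simp add: pentagon[THEN eq_compD3])
  also have "\<dots> = coev A (X \<odot> Y)"
    by (simp add: coev_def associator_nat[THEN eq_compD] dagger_left_unitor_tensor)
  finally have "(\<iota> (A\<^sup>\<star>) \<otimes> \<alpha> A X Y) \<cdot> \<alpha> (A\<^sup>\<star>) (A \<odot> X) Y \<cdot> (coev A X \<otimes> \<iota> Y) = coev A (X \<odot> Y)" .
  then have "(\<iota> (A\<^sup>\<star>) \<otimes> (\<alpha> A X Y)\<^sup>\<dagger>) \<cdot> (\<iota> (A\<^sup>\<star>) \<otimes> \<alpha> A X Y) \<cdot> \<alpha> (A\<^sup>\<star>) (A \<odot> X) Y \<cdot> (coev A X \<otimes> \<iota> Y)
      = (\<iota> (A\<^sup>\<star>) \<otimes> (\<alpha> A X Y)\<^sup>\<dagger>) \<cdot> coev A (X \<odot> Y)"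
    by (rule comp_left_cong)
  then show ?thesis by (simp add: fuse)
qed

lemma ev_tensor:
  assumes [simp]: "A \<in> obj C" "X \<in> obj C" "Y \<in> obj C"
  shows "ev A X \<otimes> \<iota> Y = ev A (X \<odot> Y) \<cdot> (\<iota> A \<otimes> \<alpha> (A\<^sup>\<star>) X Y) \<cdot> \<alpha> A (A\<^sup>\<star> \<odot> X) Y"
proof -
  have "(ev A X \<otimes> \<iota> Y) \<cdot> (\<alpha> A (A\<^sup>\<star> \<odot> X) Y)\<^sup>\<dagger> = ev A (X \<odot> Y) \<cdot> (\<iota> A \<otimes> \<alpha> (A\<^sup>\<star>) X Y)"
    using coev_tensor[of "A\<^sup>\<star>" X Y, THEN dagger_eqD] by (simp add: dagger_coev)
  then have "((ev A X \<otimes> \<iota> Y) \<cdot> (\<alpha> A (A\<^sup>\<star> \<odot> X) Y)\<^sup>\<dagger>) \<cdot> \<alpha> A (A\<^sup>\<star> \<odot> X) Y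
      = (ev A (X \<odot> Y) \<cdot> (\<iota> A \<otimes> \<alpha> (A\<^sup>\<star>) X Y)) \<cdot> \<alpha> A (A\<^sup>\<star> \<odot> X) Y"
    by (rule comp_right_cong)
  then show ?thesis by simp
qed

text \<open>A triangle identity: the mixed pentagon and naturality split off \<open>X\<close>, and
  what remains is \<open>snake_obj\<close> tensored with \<open>\<iota> X\<close>.\<close>

lemma ev_coev:
  assumes [simp]: "A \<in> obj C" "X \<in> obj C"
  shows "ev A (A \<odot> X) \<cdot> (\<iota> A \<otimes> coev A X) = \<iota> (A \<odot> X)"
proof -
  have "ev A (A \<odot> X) \<cdot> (\<iota> A \<otimes> coev A X)
      = \<l> (A \<odot> X) \<cdot> (cap C A \<otimes> \<iota> (A \<odot> X)) \<cdot> (\<alpha> A (A\<^sup>\<star>) (A \<odot> X))\<^sup>\<dagger>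
          \<cdot> (\<iota> A \<otimes> \<alpha> (A\<^sup>\<star>) A X) \<cdot> (\<iota> A \<otimes> (cup C A \<otimes> \<iota> X)) \<cdot> (\<iota> A \<otimes> (\<l> X)\<^sup>\<dagger>)"
    by (simp add: ev_def coev_def fuse)
  also have "\<dots> = \<l> (A \<odot> X) \<cdot> (cap C A \<otimes> \<iota> (A \<odot> X)) \<cdot> \<alpha> (A \<odot> A\<^sup>\<star>) A X
          \<cdot> ((\<alpha> A (A\<^sup>\<star>) A)\<^sup>\<dagger> \<otimes> \<iota> X) \<cdot> (\<alpha> A (A\<^sup>\<star> \<odot> A) X)\<^sup>\<dagger>
          \<cdot> (\<iota> A \<otimes> (cup C A \<otimes> \<iota> X)) \<cdot> (\<iota> A \<otimes> (\<l> X)\<^sup>\<dagger>)"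
    by (simp add: pentagon_mixed[THEN eq_compD])
  also have "\<dots> = \<l> (A \<odot> X) \<cdot> \<alpha> \<one> A X \<cdot> ((cap C A \<otimes> \<iota> A) \<otimes> \<iota> X)
          \<cdot> ((\<alpha> A (A\<^sup>\<star>) A)\<^sup>\<dagger> \<otimes> \<iota> X) \<cdot> ((\<iota> A \<otimes> cup C A) \<otimes> \<iota> X)
          \<cdot> (\<alpha> A \<one> X)\<^sup>\<dagger> \<cdot> (\<iota> A \<otimes> (\<l> X)\<^sup>\<dagger>)"
    by (simp add: associator_nat[THEN eq_compD] dagger_associator_nat[THEN eq_compD])
  also have "\<dots> = (\<l> A \<otimes> \<iota> X) \<cdot> ((cap C A \<otimes> \<iota> A) \<otimes> \<iota> X)
          \<cdot> ((\<alpha> A (A\<^sup>\<star>) A)\<^sup>\<dagger> \<otimes> \<iota> X) \<cdot> ((\<iota> A \<otimes> cup C A) \<otimes> \<iota> X) \<cdot> ((\<r> A)\<^sup>\<dagger> \<otimes> \<iota> X)"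
    by (simp add: left_unitor_tensor[THEN eq_compD] dagger_triangle)
  also have "\<dots> = \<iota> (A \<odot> X)"
    by (simp add: fuse snake_obj)
  finally show ?thesis .
qed

text \<open>The other triangle identity is the dagger of the first one at
  \<open>A\<^sup>\<star>\<close>.\<close>

lemma coev_ev:
  assumes [simp]: "A \<in> obj C" "Y \<in> obj C"
  shows "(\<iota> (A\<^sup>\<star>) \<otimes> ev A Y) \<cdot> coev A (A\<^sup>\<star> \<odot> Y) = \<iota> (A\<^sup>\<star> \<odot> Y)"
  using ev_coev[of "A\<^sup>\<star>" Y, THEN dagger_eqD] by (simp add: dagger_coev dagger_ev)

lemma coev_cap:
  assumes [simp]: "A \<in> obj C"
  shows "(\<iota> (A\<^sup>\<star>) \<otimes> cap C A) \<cdot> coev A (A\<^sup>\<star>) = (\<r> (A\<^sup>\<star>))\<^sup>\<dagger>"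
proof -
  have "\<r> (A\<^sup>\<star>) \<cdot> (\<iota> (A\<^sup>\<star>) \<otimes> cap C A) \<cdot> coev A (A\<^sup>\<star>) = \<iota> (A\<^sup>\<star>)"
    using snake_dual[of A] by (simp add: coev_def)
  then have "(\<r> (A\<^sup>\<star>))\<^sup>\<dagger> \<cdot> \<r> (A\<^sup>\<star>) \<cdot> (\<iota> (A\<^sup>\<star>) \<otimes> cap C A) \<cdot> coev A (A\<^sup>\<star>) = (\<r> (A\<^sup>\<star>))\<^sup>\<dagger> \<cdot> \<iota> (A\<^sup>\<star>)"
    by (rule comp_left_cong)
  then show ?thesis by simp
qed

section \<open>Recovering a morphism from its bend\<close>

text \<open>Naturality moves \<open>f\<close> past the evaluation, after which a triangle identity
  straightens the wire.\<close>

lemma ev_bend: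
  assumes [simp]: "A \<in> obj C" "X \<in> obj C" "arr f" "src f = A \<odot> X"
  shows "ev A (tgt f) \<cdot> (\<iota> A \<otimes> ((\<iota> (A\<^sup>\<star>) \<otimes> f) \<cdot> coev A X)) = f"
proof -
  have "ev A (tgt f) \<cdot> (\<iota> A \<otimes> ((\<iota> (A\<^sup>\<star>) \<otimes> f) \<cdot> coev A X))
      = ev A (tgt f) \<cdot> (\<iota> A \<otimes> (\<iota> (A\<^sup>\<star>) \<otimes> f)) \<cdot> (\<iota> A \<otimes> coev A X)"
    by (simp add: fuse)
  also have "\<dots> = f"
    by (simp add: ev_nat[THEN eq_compD] ev_coev)
  finally show ?thesis .
qed

text \<open>Evaluation undoes bending, so diagrams may be compared after a wire has been
  bent.\<close>

lemma bend_inject: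
  assumes "A \<in> obj C" "X \<in> obj C" "arr f" "src f = A \<odot> X" "arr g" "src g = A \<odot> X" "tgt f = tgt g"
    and "(\<iota> (A\<^sup>\<star>) \<otimes> f) \<cdot> coev A X = (\<iota> (A\<^sup>\<star>) \<otimes> g) \<cdot> coev A X"
  shows "f = g"
proof -
  have "f = ev A (tgt f) \<cdot> (\<iota> A \<otimes> ((\<iota> (A\<^sup>\<star>) \<otimes> f) \<cdot> coev A X))"
    by (rule ev_bend[symmetric]) fact+
  also have "\<dots> = ev A (tgt g) \<cdot> (\<iota> A \<otimes> ((\<iota> (A\<^sup>\<star>) \<otimes> g) \<cdot> coev A X))"
    by (simp only: assms(7,8))
  also have "\<dots> = g"
    by (rule ev_bend) fact+
  finally show ?thesis .
qed

text \<open>Without a bystander wire the evaluation is the cap; equality of the two unitors at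
  \<open>\<one>\<close> reconciles the coherence isomorphisms.\<close>

lemma ev_unit:
  assumes [simp]: "A \<in> obj C"
  shows "ev A \<one> = cap C A \<cdot> (\<iota> A \<otimes> \<r> (A\<^sup>\<star>))"
proof -
  have "ev A \<one> = cap C A \<cdot> \<r> (A \<odot> A\<^sup>\<star>) \<cdot> (\<alpha> A (A\<^sup>\<star>) \<one>)\<^sup>\<dagger>"
    by (simp add: ev_def unitor_unit_eq right_unitor_nat[THEN eq_compD])
  also have "\<dots> = cap C A \<cdot> (\<iota> A \<otimes> \<r> (A\<^sup>\<star>))"
    by (simp add: right_unitor_tensor[symmetric])
  finally show ?thesis .
qed

lemma cap_bend:
  assumes [simp]: "A \<in> obj C" "X \<in> obj C" "arr f" "src f = A \<odot> X" "tgt f = \<one>"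
  shows "cap C A \<cdot> (\<iota> A \<otimes> (\<r> (A\<^sup>\<star>) \<cdot> (\<iota> (A\<^sup>\<star>) \<otimes> f) \<cdot> coev A X)) = f"
  using ev_bend[of A X f] by (simp add: ev_unit fuse)

section \<open>Bending a tensor product\<close>

text \<open>Rests on the convention that the cup of \<open>B \<odot> D\<close> is the cup of
  \<open>B\<close> nested inside the cup of \<open>D\<close>; the associators carry the bystander
  \<open>X\<close> along.\<close>

lemma coev_tensor_dual:
  assumes [simp]: "B \<in> obj C" "D \<in> obj C" "X \<in> obj C"
  shows "coev (B \<odot> D) X = (\<alpha> (D\<^sup>\<star>) (B\<^sup>\<star>) ((B \<odot> D) \<odot> X))\<^sup>\<dagger>
    \<cdot> (\<iota> (D\<^sup>\<star>) \<otimes> ((\<iota> (B\<^sup>\<star>) \<otimes> (\<alpha> B D X)\<^sup>\<dagger>) \<cdot> coev B (D \<odot> X))) \<cdot> coev D X"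
proof -
  have "\<alpha> (D\<^sup>\<star>) (B\<^sup>\<star>) ((B \<odot> D) \<odot> X) \<cdot> coev (B \<odot> D) X
      = \<alpha> (D\<^sup>\<star>) (B\<^sup>\<star>) ((B \<odot> D) \<odot> X) \<cdot> \<alpha> (D\<^sup>\<star> \<odot> B\<^sup>\<star>) (B \<odot> D) X
        \<cdot> ((\<alpha> (D\<^sup>\<star>) (B\<^sup>\<star>) (B \<odot> D))\<^sup>\<dagger> \<otimes> \<iota> X) \<cdot> ((\<iota> (D\<^sup>\<star>) \<otimes> coev B D) \<otimes> \<iota> X)
        \<cdot> (cup C D \<otimes> \<iota> X) \<cdot> (\<l> X)\<^sup>\<dagger>"
    by (simp add: coev_def cup_tensor fuse)
  \<comment> \<open>The bracketed factor is the left side of the pentagon. Its last associator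
    cancels against the inverse that follows.\<close>
  also have "\<dots> = ((\<iota> (D\<^sup>\<star>) \<otimes> \<alpha> (B\<^sup>\<star>) (B \<odot> D) X) \<cdot> \<alpha> (D\<^sup>\<star>) (B\<^sup>\<star> \<odot> (B \<odot> D)) X
        \<cdot> (\<alpha> (D\<^sup>\<star>) (B\<^sup>\<star>) (B \<odot> D) \<otimes> \<iota> X))
        \<cdot> ((\<alpha> (D\<^sup>\<star>) (B\<^sup>\<star>) (B \<odot> D))\<^sup>\<dagger> \<otimes> \<iota> X) \<cdot> ((\<iota> (D\<^sup>\<star>) \<otimes> coev B D) \<otimes> \<iota> X)
        \<cdot> (cup C D \<otimes> \<iota> X) \<cdot> (\<l> X)\<^sup>\<dagger>"
    by (subst pentagon) simp_all
  also have "\<dots> = (\<iota> (D\<^sup>\<star>) \<otimes> \<alpha> (B\<^sup>\<star>) (B \<odot> D) X) \<cdot> \<alpha> (D\<^sup>\<star>) (B\<^sup>\<star> \<odot> (B \<odot> D)) X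
        \<cdot> ((\<iota> (D\<^sup>\<star>) \<otimes> coev B D) \<otimes> \<iota> X) \<cdot> (cup C D \<otimes> \<iota> X) \<cdot> (\<l> X)\<^sup>\<dagger>"
    by (simp add: fuse)
  also have "\<dots> = (\<iota> (D\<^sup>\<star>) \<otimes> \<alpha> (B\<^sup>\<star>) (B \<odot> D) X) \<cdot> (\<iota> (D\<^sup>\<star>) \<otimes> (coev B D \<otimes> \<iota> X)) \<cdot> coev D X"
    by (simp add: coev_def[of D X] associator_nat[THEN eq_compD])
  also have "\<dots> = (\<iota> (D\<^sup>\<star>) \<otimes> ((\<iota> (B\<^sup>\<star>) \<otimes> (\<alpha> B D X)\<^sup>\<dagger>) \<cdot> coev B (D \<odot> X))) \<cdot> coev D X"
    by (simp add: fuse coev_tensor)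
  finally have "(\<alpha> (D\<^sup>\<star>) (B\<^sup>\<star>) ((B \<odot> D) \<odot> X))\<^sup>\<dagger> \<cdot> \<alpha> (D\<^sup>\<star>) (B\<^sup>\<star>) ((B \<odot> D) \<odot> X) \<cdot> coev (B \<odot> D) X
      = (\<alpha> (D\<^sup>\<star>) (B\<^sup>\<star>) ((B \<odot> D) \<odot> X))\<^sup>\<dagger>
        \<cdot> (\<iota> (D\<^sup>\<star>) \<otimes> ((\<iota> (B\<^sup>\<star>) \<otimes> (\<alpha> B D X)\<^sup>\<dagger>) \<cdot> coev B (D \<odot> X))) \<cdot> coev D X"
    by (rule comp_left_cong)
  then show ?thesis by simp
qed

text \<open>The nested form of \<open>coev\<close> lets two wires be bent in turn, first
  \<open>B\<close> and then \<open>D\<close>, so that facts about one bent wire apply to tensor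
  products.\<close>

lemma bend_tensor:
  assumes [simp]: "B \<in> obj C" "D \<in> obj C" "X \<in> obj C" "arr f" "src f = (B \<odot> D) \<odot> X"
  shows "(\<iota> (D\<^sup>\<star> \<odot> B\<^sup>\<star>) \<otimes> f) \<cdot> coev (B \<odot> D) X = (\<alpha> (D\<^sup>\<star>) (B\<^sup>\<star>) (tgt f))\<^sup>\<dagger>
    \<cdot> (\<iota> (D\<^sup>\<star>) \<otimes> ((\<iota> (B\<^sup>\<star>) \<otimes> (f \<cdot> (\<alpha> B D X)\<^sup>\<dagger>)) \<cdot> coev B (D \<odot> X))) \<cdot> coev D X"
proof -
  have "(\<iota> (D\<^sup>\<star> \<odot> B\<^sup>\<star>) \<otimes> f) \<cdot> (\<alpha> (D\<^sup>\<star>) (B\<^sup>\<star>) ((B \<odot> D) \<odot> X))\<^sup>\<dagger>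
      = (\<alpha> (D\<^sup>\<star>) (B\<^sup>\<star>) (tgt f))\<^sup>\<dagger> \<cdot> (\<iota> (D\<^sup>\<star>) \<otimes> (\<iota> (B\<^sup>\<star>) \<otimes> f))"
    by (simp add: dagger_associator_nat)
  note * = this[THEN eq_compD]
  show ?thesis
    by (simp add: coev_tensor_dual * fuse)
qed

text \<open>Caps are determined by cups through the snake equations, so it suffices that the nested caps
  straighten the nested cups.\<close>

lemma cap_tensor:
  assumes [simp]: "B \<in> obj C" "D \<in> obj C"
  shows "cap C (B \<odot> D) = cap C B \<cdot> (\<iota> B \<otimes> ev D (B\<^sup>\<star>)) \<cdot> \<alpha> B D (D\<^sup>\<star> \<odot> B\<^sup>\<star>)"
    (is "_ = ?d")
proof (rule bend_inject[of "B \<odot> D" "(B \<odot> D)\<^sup>\<star>"])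
  have "(\<iota> ((B \<odot> D)\<^sup>\<star>) \<otimes> ?d) \<cdot> coev (B \<odot> D) ((B \<odot> D)\<^sup>\<star>)
      = (\<alpha> (D\<^sup>\<star>) (B\<^sup>\<star>) \<one>)\<^sup>\<dagger> \<cdot> (\<iota> (D\<^sup>\<star>) \<otimes> ((\<iota> (B\<^sup>\<star>) \<otimes> (cap C B \<cdot> (\<iota> B \<otimes> ev D (B\<^sup>\<star>))))
          \<cdot> coev B (D \<odot> (D\<^sup>\<star> \<odot> B\<^sup>\<star>)))) \<cdot> coev D (D\<^sup>\<star> \<odot> B\<^sup>\<star>)"
    by (simp add: bend_tensor)
  also have "(\<iota> (B\<^sup>\<star>) \<otimes> (cap C B \<cdot> (\<iota> B \<otimes> ev D (B\<^sup>\<star>)))) \<cdot> coev B (D \<odot> (D\<^sup>\<star> \<odot> B\<^sup>\<star>))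
      = (\<iota> (B\<^sup>\<star>) \<otimes> cap C B) \<cdot> coev B (B\<^sup>\<star>) \<cdot> ev D (B\<^sup>\<star>)"
    by (simp add: coev_nat fuse)
  also have "\<dots> = (\<r> (B\<^sup>\<star>))\<^sup>\<dagger> \<cdot> ev D (B\<^sup>\<star>)"
    by (simp add: coev_cap[THEN eq_compD])
  also have "(\<alpha> (D\<^sup>\<star>) (B\<^sup>\<star>) \<one>)\<^sup>\<dagger> \<cdot> (\<iota> (D\<^sup>\<star>) \<otimes> ((\<r> (B\<^sup>\<star>))\<^sup>\<dagger> \<cdot> ev D (B\<^sup>\<star>))) \<cdot> coev D (D\<^sup>\<star> \<odot> B\<^sup>\<star>)
      = (\<alpha> (D\<^sup>\<star>) (B\<^sup>\<star>) \<one>)\<^sup>\<dagger> \<cdot> (\<iota> (D\<^sup>\<star>) \<otimes> (\<r> (B\<^sup>\<star>))\<^sup>\<dagger>) \<cdot> (\<iota> (D\<^sup>\<star>) \<otimes> ev D (B\<^sup>\<star>)) \<cdot> coev D (D\<^sup>\<star> \<odot> B\<^sup>\<star>)"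
    by (simp add: fuse)
  also have "\<dots> = (\<r> (D\<^sup>\<star> \<odot> B\<^sup>\<star>))\<^sup>\<dagger>"
    by (simp add: coev_ev dagger_right_unitor_tensor)
  finally show "(\<iota> ((B \<odot> D)\<^sup>\<star>) \<otimes> cap C (B \<odot> D)) \<cdot> coev (B \<odot> D) ((B \<odot> D)\<^sup>\<star>)
      = (\<iota> ((B \<odot> D)\<^sup>\<star>) \<otimes> ?d) \<cdot> coev (B \<odot> D) ((B \<odot> D)\<^sup>\<star>)"
    using coev_cap[of "B \<odot> D"] by simp
qed simp_all

text \<open>Gives conjugates the same bent shape as \<open>i\<close> and \<open>R\<close> below, so
  that comparisons can be made underneath the bend.\<close>

lemma conjugate_eq_bend:
  assumes "A \<in> obj C" "B \<in> obj C" "arr f" "src f = A" "tgt f = B"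
  shows "conjugate C A B f = \<r> (B\<^sup>\<star>) \<cdot> (\<iota> (B\<^sup>\<star>) \<otimes> (cap C A \<cdot> (f\<^sup>\<dagger> \<otimes> \<iota> (A\<^sup>\<star>)))) \<cdot> coev B (A\<^sup>\<star>)"
  using assms by (simp add: conjugate_def coev_def fuse)

lemma pants_mult_eq: "pants_mult C A = (\<iota> (A\<^sup>\<star>) \<otimes> ev A A) \<cdot> \<alpha> (A\<^sup>\<star>) A (A\<^sup>\<star> \<odot> A)"
  by (simp add: pants_mult_def ev_def)

end

section \<open>Monoids and their pairing\<close>

locale monoid_in_compact = compact_dagger_category +
  fixes A m e
  assumes monoid_in: "monoid_in C A m e"
begin

lemma monoid_obj [simp]: "A \<in> obj C"
  and arr_mult [simp]: "arr m" and src_mult [simp]: "src m = A \<odot> A" and tgt_mult [simp]: "tgt m = A"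
  and arr_unit [simp]: "arr e" and src_unit [simp]: "src e = \<one>" and tgt_unit [simp]: "tgt e = A"
  and mult_assoc: "m \<cdot> (m \<otimes> \<iota> A) = m \<cdot> (\<iota> A \<otimes> m) \<cdot> \<alpha> A A A"
  and mult_left_unit: "m \<cdot> (e \<otimes> \<iota> A) = \<l> A"
  and mult_right_unit: "m \<cdot> (\<iota> A \<otimes> e) = \<r> A"
  using monoid_in by (simp_all add: monoid_in_def in_hom_iff)

text \<open>The candidate Frobenius form, with \<open>e\<^sup>\<dagger>\<close> as counit.\<close>

definition pairing where
  "pairing = e\<^sup>\<dagger> \<cdot> m"

definition "i = induced_involution C A m e"

definition "R = cayley_embedding C A m"

text \<open>The morphism \<open>q\<close> of the introduction.\<close>

definition transposed_comult where
  "transposed_comult = \<r> A \<cdot> (\<iota> A \<otimes> pairing) \<cdot> \<alpha> A A A \<cdot> (m\<^sup>\<dagger> \<otimes> \<iota> A)"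

lemma arr_pairing [simp]: "arr pairing"
  and src_pairing [simp]: "src pairing = A \<odot> A"
  and tgt_pairing [simp]: "tgt pairing = \<one>"
  by (simp_all add: pairing_def)

lemma i_eq_bend: "i = \<r> (A\<^sup>\<star>) \<cdot> (\<iota> (A\<^sup>\<star>) \<otimes> pairing) \<cdot> coev A A"
  by (simp add: i_def induced_involution_def pairing_def coev_def)

lemma R_eq_bend: "R = (\<iota> (A\<^sup>\<star>) \<otimes> m) \<cdot> coev A A"
  by (simp add: R_def cayley_embedding_def coev_def)

lemma arr_i [simp]: "arr i" and src_i [simp]: "src i = A" and tgt_i [simp]: "tgt i = A\<^sup>\<star>"
  by (simp_all add: i_eq_bend)

lemma arr_R [simp]: "arr R" and src_R [simp]: "src R = A" and tgt_R [simp]: "tgt R = A\<^sup>\<star> \<odot> A"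
  by (simp_all add: R_eq_bend)

lemma pairing_assoc: "pairing \<cdot> (m \<otimes> \<iota> A) = pairing \<cdot> (\<iota> A \<otimes> m) \<cdot> \<alpha> A A A"
  by (simp add: pairing_def mult_assoc)

lemma cap_i: "cap C A \<cdot> (\<iota> A \<otimes> i) = pairing"
  by (simp add: i_eq_bend cap_bend)

text \<open>Interchange isolates the leg carrying \<open>i\<close>, where the cap straightens the
  bend and leaves the pairing.\<close>

lemma cap_tensor_i:
  assumes "arr f" "tgt f = A"
  shows "cap C A \<cdot> (f \<otimes> i) = pairing \<cdot> (f \<otimes> \<iota> A)"
proof -
  have "cap C A \<cdot> (f \<otimes> i) = (cap C A \<cdot> (\<iota> A \<otimes> i)) \<cdot> (f \<otimes> \<iota> A)"
    using assms by (simp add: fuse)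
  then show ?thesis by (simp only: cap_i)
qed

section \<open>Daggers of \<open>R\<close> and \<open>i\<close>, and the conjugate of
  \<open>R\<close>\<close>

lemma dagger_R: "R\<^sup>\<dagger> = ev (A\<^sup>\<star>) A \<cdot> (\<iota> (A\<^sup>\<star>) \<otimes> m\<^sup>\<dagger>)"
  by (simp add: R_eq_bend dagger_coev)

lemma dagger_i: "i\<^sup>\<dagger> = ev (A\<^sup>\<star>) A \<cdot> (\<iota> (A\<^sup>\<star>) \<otimes> pairing\<^sup>\<dagger>) \<cdot> (\<r> (A\<^sup>\<star>))\<^sup>\<dagger>"
  by (simp add: i_eq_bend dagger_coev)

text \<open>Both \<open>R\<^sup>\<dagger>\<close> and \<open>i\<^sup>\<dagger>\<close> contain an
  evaluation of this shape, with \<open>f\<close> equal to \<open>m\<^sup>\<dagger>\<close> and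
  \<open>pairing\<^sup>\<dagger>\<close> respectively. Moving the evaluation outside brings the
  pairing directly onto \<open>f\<close>.\<close>

lemma pairing_ev:
  assumes [simp]: "arr f" "tgt f = A \<odot> A"
  shows "pairing \<cdot> ((ev (A\<^sup>\<star>) A \<cdot> (\<iota> (A\<^sup>\<star>) \<otimes> f)) \<otimes> \<iota> A)
    = ev (A\<^sup>\<star>) \<one> \<cdot> (\<iota> (A\<^sup>\<star>) \<otimes> ((\<iota> A \<otimes> pairing) \<cdot> \<alpha> A A A \<cdot> (f \<otimes> \<iota> A))) \<cdot> \<alpha> (A\<^sup>\<star>) (src f) A"
proof -
  have "pairing \<cdot> ((ev (A\<^sup>\<star>) A \<cdot> (\<iota> (A\<^sup>\<star>) \<otimes> f)) \<otimes> \<iota> A)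
      = pairing \<cdot> (ev (A\<^sup>\<star>) A \<otimes> \<iota> A) \<cdot> ((\<iota> (A\<^sup>\<star>) \<otimes> f) \<otimes> \<iota> A)"
    by (simp add: fuse)
  also have "\<dots> = pairing \<cdot> ev (A\<^sup>\<star>) (A \<odot> A) \<cdot> (\<iota> (A\<^sup>\<star>) \<otimes> \<alpha> A A A)
        \<cdot> (\<iota> (A\<^sup>\<star>) \<otimes> (f \<otimes> \<iota> A)) \<cdot> \<alpha> (A\<^sup>\<star>) (src f) A"
    by (simp add: ev_tensor associator_nat)
  also have "\<dots> = (ev (A\<^sup>\<star>) \<one> \<cdot> (\<iota> (A\<^sup>\<star>) \<otimes> (\<iota> A \<otimes> pairing))) \<cdot> (\<iota> (A\<^sup>\<star>) \<otimes> \<alpha> A A A)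
        \<cdot> (\<iota> (A\<^sup>\<star>) \<otimes> (f \<otimes> \<iota> A)) \<cdot> \<alpha> (A\<^sup>\<star>) (src f) A"
    using ev_nat[of "A\<^sup>\<star>" pairing \<one>] by simp
  also have "\<dots> = ev (A\<^sup>\<star>) \<one> \<cdot> (\<iota> (A\<^sup>\<star>) \<otimes> ((\<iota> A \<otimes> pairing) \<cdot> \<alpha> A A A \<cdot> (f \<otimes> \<iota> A))) \<cdot> \<alpha> (A\<^sup>\<star>) (src f) A"
    by (simp add: fuse)
  finally show ?thesis .
qed

text \<open>Bending the wire \<open>A\<^sup>\<star> \<odot> A\<close> splits into two bends. The one
  at \<open>A\<^sup>\<star>\<close> straightens against the evaluation inside
  \<open>R\<^sup>\<dagger>\<close>, and the one at \<open>A\<close> survives in the result.\<close>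

lemma conjugate_R_i:
  "conjugate C A (A\<^sup>\<star> \<odot> A) R \<cdot> i = (\<iota> (A\<^sup>\<star>) \<otimes> transposed_comult) \<cdot> coev A A"
proof -
  let ?q = "(\<iota> A \<otimes> pairing) \<cdot> \<alpha> A A A \<cdot> (m\<^sup>\<dagger> \<otimes> \<iota> A)"
  let ?f = "pairing \<cdot> (R\<^sup>\<dagger> \<otimes> \<iota> A)"
  \<comment> \<open>The inverse associator is included because \<open>bend_tensor\<close> leaves
    exactly this composite under the inner bend.\<close>
  have f: "?f \<cdot> (\<alpha> (A\<^sup>\<star>) A A)\<^sup>\<dagger> = ev (A\<^sup>\<star>) \<one> \<cdot> (\<iota> (A\<^sup>\<star>) \<otimes> ?q)"
    by (simp add: dagger_R pairing_ev)
  have "conjugate C A (A\<^sup>\<star> \<odot> A) R \<cdot> i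
      = \<r> (A\<^sup>\<star> \<odot> A) \<cdot> (\<iota> (A\<^sup>\<star> \<odot> A) \<otimes> (cap C A \<cdot> (R\<^sup>\<dagger> \<otimes> i))) \<cdot> coev (A\<^sup>\<star> \<odot> A) A"
    by (simp add: conjugate_eq_bend coev_nat fuse)
  also have "\<dots> = \<r> (A\<^sup>\<star> \<odot> A) \<cdot> (\<iota> (A\<^sup>\<star> \<odot> A) \<otimes> ?f) \<cdot> coev (A\<^sup>\<star> \<odot> A) A"
    by (simp add: cap_tensor_i)
  also have "\<dots> = \<r> (A\<^sup>\<star> \<odot> A) \<cdot> (\<alpha> (A\<^sup>\<star>) A \<one>)\<^sup>\<dagger>
      \<cdot> (\<iota> (A\<^sup>\<star>) \<otimes> ((\<iota> A \<otimes> (?f \<cdot> (\<alpha> (A\<^sup>\<star>) A A)\<^sup>\<dagger>)) \<cdot> coev (A\<^sup>\<star>) (A \<odot> A))) \<cdot> coev A A"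
    using bend_tensor[of "A\<^sup>\<star>" A A ?f] by simp
  \<comment> \<open>Naturality carries \<open>?q\<close> out of the inner bend, leaving a triangle
    identity.\<close>
  also have "(\<iota> A \<otimes> (?f \<cdot> (\<alpha> (A\<^sup>\<star>) A A)\<^sup>\<dagger>)) \<cdot> coev (A\<^sup>\<star>) (A \<odot> A)
      = (\<iota> A \<otimes> ev (A\<^sup>\<star>) \<one>) \<cdot> coev (A\<^sup>\<star>) (A \<odot> \<one>) \<cdot> ?q"
    unfolding f by (simp add: coev_nat fuse)
  also have "\<dots> = ?q"
    using coev_ev[of "A\<^sup>\<star>" \<one>, THEN eq_compD, of ?q] by simp
  also have "\<r> (A\<^sup>\<star> \<odot> A) \<cdot> (\<alpha> (A\<^sup>\<star>) A \<one>)\<^sup>\<dagger> \<cdot> (\<iota> (A\<^sup>\<star>) \<otimes> ?q) \<cdot> coev A A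
      = (\<iota> (A\<^sup>\<star>) \<otimes> \<r> A) \<cdot> (\<iota> (A\<^sup>\<star>) \<otimes> ?q) \<cdot> coev A A"
    by (simp add: right_unitor_tensor[symmetric])
  also have "\<dots> = (\<iota> (A\<^sup>\<star>) \<otimes> transposed_comult) \<cdot> coev A A"
    by (simp add: fuse transposed_comult_def)
  finally show ?thesis .
qed

text \<open>Both morphisms are bends of a first input, and bending is injective.\<close>

lemma R_eq_conjugate_R_i_iff:
  "R = conjugate C A (A\<^sup>\<star> \<odot> A) R \<cdot> i \<longleftrightarrow> m = transposed_comult"
proof
  assume "R = conjugate C A (A\<^sup>\<star> \<odot> A) R \<cdot> i"
  then have "(\<iota> (A\<^sup>\<star>) \<otimes> m) \<cdot> coev A A = (\<iota> (A\<^sup>\<star>) \<otimes> transposed_comult) \<cdot> coev A A"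
    unfolding conjugate_R_i unfolding R_eq_bend .
  then show "m = transposed_comult"
    by (rule bend_inject[rotated -1]) (simp_all add: transposed_comult_def)
next
  assume "m = transposed_comult"
  then show "R = conjugate C A (A\<^sup>\<star> \<odot> A) R \<cdot> i"
    unfolding conjugate_R_i unfolding R_eq_bend by simp
qed

section \<open>\<open>R\<close> as a monoid homomorphism\<close>

text \<open>Cayley's argument: unbent, \<open>R\<close> is the action by right multiplication, and
  the pair of pants composes such actions. Underneath the bend the identity is associativity of
  \<open>m\<close>.\<close>

lemma R_mult: "R \<cdot> m = pants_mult C A \<cdot> (R \<otimes> R)"
proof -
  have "pants_mult C A \<cdot> (R \<otimes> R)
      = (\<iota> (A\<^sup>\<star>) \<otimes> ev A A) \<cdot> \<alpha> (A\<^sup>\<star>) A (A\<^sup>\<star> \<odot> A)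
          \<cdot> ((\<iota> (A\<^sup>\<star>) \<otimes> m) \<otimes> R) \<cdot> (coev A A \<otimes> \<iota> A)"
    by (simp add: pants_mult_eq R_eq_bend fuse)
  also have "\<dots> = (\<iota> (A\<^sup>\<star>) \<otimes> ev A A) \<cdot> (\<iota> (A\<^sup>\<star>) \<otimes> (m \<otimes> R))
          \<cdot> \<alpha> (A\<^sup>\<star>) (A \<odot> A) A \<cdot> (coev A A \<otimes> \<iota> A)"
    by (simp add: associator_nat[THEN eq_compD])
  also have "\<dots> = (\<iota> (A\<^sup>\<star>) \<otimes> ((ev A A \<cdot> (\<iota> A \<otimes> R)) \<cdot> (m \<otimes> \<iota> A) \<cdot> (\<alpha> A A A)\<^sup>\<dagger>)) \<cdot> coev A (A \<odot> A)"
    by (simp add: coev_tensor fuse)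
  \<comment> \<open>The wire joining the two copies of \<open>R\<close> straightens and turns the
    second copy into \<open>m\<close>.\<close>
  also have "ev A A \<cdot> (\<iota> A \<otimes> R) = m"
    using ev_bend[of A A m] by (simp add: R_eq_bend)
  also have "m \<cdot> (m \<otimes> \<iota> A) \<cdot> (\<alpha> A A A)\<^sup>\<dagger> = m \<cdot> (\<iota> A \<otimes> m)"
    by (simp add: mult_assoc[THEN eq_compD])
  also have "(\<iota> (A\<^sup>\<star>) \<otimes> (m \<cdot> (\<iota> A \<otimes> m))) \<cdot> coev A (A \<odot> A) = R \<cdot> m"
    by (simp add: R_eq_bend coev_nat fuse)
  finally show ?thesis by simp
qed

text \<open>The right unit law leaves only the bent wire, which is the cup.\<close>

lemma R_unit: "R \<cdot> e = pants_unit C A"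
proof -
  have "R \<cdot> e = (\<iota> (A\<^sup>\<star>) \<otimes> (m \<cdot> (\<iota> A \<otimes> e))) \<cdot> coev A \<one>"
    by (simp add: R_eq_bend coev_nat fuse)
  also have "\<dots> = (\<iota> (A\<^sup>\<star>) \<otimes> \<r> A) \<cdot> \<alpha> (A\<^sup>\<star>) A \<one> \<cdot> (cup C A \<otimes> \<iota> \<one>) \<cdot> (\<r> \<one>)\<^sup>\<dagger>"
    by (simp add: mult_right_unit coev_def unitor_unit_eq)
  also have "\<dots> = cup C A"
    by (simp add: right_unitor_tensor[THEN eq_compD] right_unitor_nat[THEN eq_compD])
  finally show ?thesis by (simp add: pants_unit_def)
qed

section \<open>\<open>i\<close> as an involution\<close>

text \<open>Underneath the bend, the right unit law reduces pairing with \<open>e\<close> to the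
  counit. Since the cap of \<open>\<one>\<close> is a unitor, the conjugate of \<open>e\<close>
  bends the same effect.\<close>

lemma i_unit: "i \<cdot> e = op_unit C A e"
proof -
  have "i \<cdot> e = \<r> (A\<^sup>\<star>) \<cdot> (\<iota> (A\<^sup>\<star>) \<otimes> (pairing \<cdot> (\<iota> A \<otimes> e))) \<cdot> coev A \<one>"
    by (simp add: i_eq_bend coev_nat fuse)
  also have "pairing \<cdot> (\<iota> A \<otimes> e) = cap C \<one> \<cdot> (e\<^sup>\<dagger> \<otimes> \<iota> \<one>)"
    by (simp add: pairing_def mult_right_unit cap_unit right_unitor_nat)
  finally show ?thesis
    by (simp add: op_unit_def conjugate_eq_bend)
qed

text \<open>Both sides are bends of effects on \<open>A \<odot> (A \<odot> A)\<close>. On the right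
  the cap of \<open>A \<odot> A\<close> is two nested caps; the inner one and
  \<open>m\<^sup>\<dagger>\<close> form \<open>transposed_comult\<close>, and once this is replaced
  by \<open>m\<close>, associativity of the pairing finishes.\<close>

lemma i_mult:
  assumes m: "m = transposed_comult"
  shows "i \<cdot> m = op_mult C A m \<cdot> (i \<otimes> i)"
proof -
  have "op_mult C A m \<cdot> (i \<otimes> i)
      = \<r> (A\<^sup>\<star>) \<cdot> (\<iota> (A\<^sup>\<star>) \<otimes> (cap C (A \<odot> A) \<cdot> (m\<^sup>\<dagger> \<otimes> (i \<otimes> i)))) \<cdot> coev A (A \<odot> A)"
    by (simp add: op_mult_def conjugate_eq_bend coev_nat fuse)
  also have "cap C (A \<odot> A) \<cdot> (m\<^sup>\<dagger> \<otimes> (i \<otimes> i))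
      = cap C A \<cdot> (\<iota> A \<otimes> ev A (A\<^sup>\<star>)) \<cdot> \<alpha> A A (A\<^sup>\<star> \<odot> A\<^sup>\<star>) \<cdot> (\<iota> (A \<odot> A) \<otimes> (i \<otimes> i)) \<cdot> (m\<^sup>\<dagger> \<otimes> \<iota> (A \<odot> A))"
    by (simp add: cap_tensor fuse)
  also have "\<dots> = cap C A \<cdot> (\<iota> A \<otimes> (ev A (A\<^sup>\<star>) \<cdot> (\<iota> A \<otimes> (i \<otimes> i)))) \<cdot> \<alpha> A A (A \<odot> A) \<cdot> (m\<^sup>\<dagger> \<otimes> \<iota> (A \<odot> A))"
    by (subst associator_nat_ident[THEN eq_compD]) (simp_all add: fuse)
  \<comment> \<open>The inner cap meets the first copy of \<open>i\<close>, so \<open>cap_i\<close>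
    can trade both for the pairing.\<close>
  also have "ev A (A\<^sup>\<star>) \<cdot> (\<iota> A \<otimes> (i \<otimes> i)) = \<l> (A\<^sup>\<star>) \<cdot> ((cap C A \<cdot> (\<iota> A \<otimes> i)) \<otimes> i) \<cdot> (\<alpha> A A A)\<^sup>\<dagger>"
    by (simp add: ev_def dagger_associator_nat fuse)
  also have "\<dots> = \<l> (A\<^sup>\<star>) \<cdot> (\<iota> \<one> \<otimes> i) \<cdot> (pairing \<otimes> \<iota> A) \<cdot> (\<alpha> A A A)\<^sup>\<dagger>"
    unfolding cap_i by (simp add: fuse)
  also have "\<dots> = i \<cdot> \<l> A \<cdot> (pairing \<otimes> \<iota> A) \<cdot> (\<alpha> A A A)\<^sup>\<dagger>"
    by (simp add: left_unitor_nat[THEN eq_compD])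
  also have "cap C A \<cdot> (\<iota> A \<otimes> (i \<cdot> \<l> A \<cdot> (pairing \<otimes> \<iota> A) \<cdot> (\<alpha> A A A)\<^sup>\<dagger>)) \<cdot> \<alpha> A A (A \<odot> A) \<cdot> (m\<^sup>\<dagger> \<otimes> \<iota> (A \<odot> A))
      = (cap C A \<cdot> (\<iota> A \<otimes> i)) \<cdot> (\<iota> A \<otimes> \<l> A) \<cdot> (\<iota> A \<otimes> (pairing \<otimes> \<iota> A)) \<cdot> (\<iota> A \<otimes> (\<alpha> A A A)\<^sup>\<dagger>)
          \<cdot> \<alpha> A A (A \<odot> A) \<cdot> (m\<^sup>\<dagger> \<otimes> \<iota> (A \<odot> A))"
    by (simp add: fuse)
  also have "\<dots> = pairing \<cdot> (\<iota> A \<otimes> \<l> A) \<cdot> (\<iota> A \<otimes> (pairing \<otimes> \<iota> A)) \<cdot> ((\<iota> A \<otimes> (\<alpha> A A A)\<^sup>\<dagger>)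
          \<cdot> \<alpha> A A (A \<odot> A)) \<cdot> (m\<^sup>\<dagger> \<otimes> \<iota> (A \<odot> A))"
    unfolding cap_i by simp
  \<comment> \<open>The dagger of the mixed pentagon moves the last input outside, so that the other
    two feed \<open>transposed_comult\<close>.\<close>
  also have "(\<iota> A \<otimes> (\<alpha> A A A)\<^sup>\<dagger>) \<cdot> \<alpha> A A (A \<odot> A) = \<alpha> A (A \<odot> A) A \<cdot> (\<alpha> A A A \<otimes> \<iota> A) \<cdot> (\<alpha> (A \<odot> A) A A)\<^sup>\<dagger>"
    using pentagon_mixed[of A A A A, THEN dagger_eqD] by simp
  also have "pairing \<cdot> (\<iota> A \<otimes> \<l> A) \<cdot> (\<iota> A \<otimes> (pairing \<otimes> \<iota> A)) \<cdot> (\<alpha> A (A \<odot> A) A \<cdot> (\<alpha> A A A \<otimes> \<iota> A)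
          \<cdot> (\<alpha> (A \<odot> A) A A)\<^sup>\<dagger>) \<cdot> (m\<^sup>\<dagger> \<otimes> \<iota> (A \<odot> A))
      = pairing \<cdot> (\<iota> A \<otimes> \<l> A) \<cdot> \<alpha> A \<one> A \<cdot> ((\<iota> A \<otimes> pairing) \<otimes> \<iota> A) \<cdot> (\<alpha> A A A \<otimes> \<iota> A)
          \<cdot> ((m\<^sup>\<dagger> \<otimes> \<iota> A) \<otimes> \<iota> A) \<cdot> (\<alpha> A A A)\<^sup>\<dagger>"
    by (simp add: associator_nat[THEN eq_compD] dagger_associator_nat_ident)
  also have "\<dots> = pairing \<cdot> (transposed_comult \<otimes> \<iota> A) \<cdot> (\<alpha> A A A)\<^sup>\<dagger>"
    by (simp add: triangle[THEN eq_compD] transposed_comult_def fuse)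
  also have "\<dots> = pairing \<cdot> (\<iota> A \<otimes> m)"
    unfolding m[symmetric] by (simp add: pairing_assoc[THEN eq_compD])
  also have "\<r> (A\<^sup>\<star>) \<cdot> (\<iota> (A\<^sup>\<star>) \<otimes> (pairing \<cdot> (\<iota> A \<otimes> m))) \<cdot> coev A (A \<odot> A) = i \<cdot> m"
    by (simp add: i_eq_bend coev_nat fuse)
  finally show ?thesis by simp
qed

text \<open>Since \<open>pairing\<^sup>\<dagger>\<close> is
  \<open>m\<^sup>\<dagger> \<cdot> e\<close>, the snake is \<open>transposed_comult\<close> with the
  unit inserted, and the hypothesis reduces it to the left unit law.\<close>

lemma pairing_snake:
  assumes m: "m = transposed_comult"
  shows "\<r> A \<cdot> (\<iota> A \<otimes> pairing) \<cdot> \<alpha> A A A \<cdot> (pairing\<^sup>\<dagger> \<otimes> \<iota> A) \<cdot> (\<l> A)\<^sup>\<dagger> = \<iota> A"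
proof -
  have "\<r> A \<cdot> (\<iota> A \<otimes> pairing) \<cdot> \<alpha> A A A \<cdot> (pairing\<^sup>\<dagger> \<otimes> \<iota> A) \<cdot> (\<l> A)\<^sup>\<dagger>
      = transposed_comult \<cdot> (e \<otimes> \<iota> A) \<cdot> (\<l> A)\<^sup>\<dagger>"
    by (simp add: transposed_comult_def pairing_def fuse)
  also have "\<dots> = \<iota> A"
    unfolding m[symmetric] by (simp add: mult_left_unit[THEN eq_compD])
  finally show ?thesis .
qed

text \<open>The snake of the pairing makes \<open>i\<^sup>\<dagger> \<otimes> i\<close> carry the
  cap of \<open>A\<close> to the cap of \<open>A\<^sup>\<star>\<close>. Underneath the bend this
  leaves a snake of the compact structure.\<close>

lemma conjugate_i_i:
  assumes m: "m = transposed_comult"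
  shows "conjugate C A (A\<^sup>\<star>) i \<cdot> i = \<iota> A"
proof -
  let ?z = "(\<iota> A \<otimes> pairing) \<cdot> \<alpha> A A A \<cdot> (pairing\<^sup>\<dagger> \<otimes> \<iota> A)"
  \<comment> \<open>Moving the right unitor across isolates \<open>?z\<close>, the form in which the
    snake occurs below.\<close>
  have "(\<r> A)\<^sup>\<dagger> \<cdot> \<r> A \<cdot> ?z \<cdot> (\<l> A)\<^sup>\<dagger> = (\<r> A)\<^sup>\<dagger> \<cdot> \<iota> A"
    using pairing_snake[OF m] by (intro comp_left_cong) simp
  then have z: "?z \<cdot> (\<l> A)\<^sup>\<dagger> = (\<r> A)\<^sup>\<dagger>"
    by simp
  have "cap C A \<cdot> (i\<^sup>\<dagger> \<otimes> i) = pairing \<cdot> (i\<^sup>\<dagger> \<otimes> \<iota> A)"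
    by (simp add: cap_tensor_i)
  also have "\<dots> = (pairing \<cdot> ((ev (A\<^sup>\<star>) A \<cdot> (\<iota> (A\<^sup>\<star>) \<otimes> pairing\<^sup>\<dagger>)) \<otimes> \<iota> A)) \<cdot> ((\<r> (A\<^sup>\<star>))\<^sup>\<dagger> \<otimes> \<iota> A)"
    by (simp add: dagger_i fuse)
  also have "\<dots> = ev (A\<^sup>\<star>) \<one> \<cdot> (\<iota> (A\<^sup>\<star>) \<otimes> ?z) \<cdot> \<alpha> (A\<^sup>\<star>) \<one> A \<cdot> ((\<r> (A\<^sup>\<star>))\<^sup>\<dagger> \<otimes> \<iota> A)"
    by (subst pairing_ev) simp_all
  also have "\<dots> = ev (A\<^sup>\<star>) \<one> \<cdot> (\<iota> (A\<^sup>\<star>) \<otimes> ?z) \<cdot> (\<iota> (A\<^sup>\<star>) \<otimes> (\<l> A)\<^sup>\<dagger>)"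
    by (simp add: dagger_triangle[symmetric])
  also have "\<dots> = ev (A\<^sup>\<star>) \<one> \<cdot> (\<iota> (A\<^sup>\<star>) \<otimes> (?z \<cdot> (\<l> A)\<^sup>\<dagger>))"
    by (simp add: fuse)
  also have "\<dots> = cap C (A\<^sup>\<star>)"
    unfolding z by (simp add: ev_unit fuse)
  finally have c: "cap C A \<cdot> (i\<^sup>\<dagger> \<otimes> i) = cap C (A\<^sup>\<star>)" .
  have "conjugate C A (A\<^sup>\<star>) i \<cdot> i = \<r> A \<cdot> (\<iota> A \<otimes> (cap C A \<cdot> (i\<^sup>\<dagger> \<otimes> i))) \<cdot> coev (A\<^sup>\<star>) A"
    by (simp add: conjugate_eq_bend coev_nat fuse)
  also have "\<dots> = \<iota> A"
    unfolding c using coev_cap[of "A\<^sup>\<star>"] by simp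
  finally show ?thesis .
qed

section \<open>The Frobenius law as the equation \<open>m = transposed_comult\<close>\<close>

text \<open>Applying \<open>e\<^sup>\<dagger>\<close> to the second output turns the left side of
  the law into \<open>transposed_comult\<close>. On the right it slides past \<open>m\<close> and is
  absorbed by the counit law, the dagger of the right unit law.\<close>

lemma frobenius_imp_transposed_comult:
  assumes "frobenius_monoid C A m e"
  shows "m = transposed_comult"
proof -
  have F: "(\<iota> A \<otimes> m) \<cdot> \<alpha> A A A \<cdot> (m\<^sup>\<dagger> \<otimes> \<iota> A) = (m \<otimes> \<iota> A) \<cdot> (\<alpha> A A A)\<^sup>\<dagger> \<cdot> (\<iota> A \<otimes> m\<^sup>\<dagger>)"
    using assms by (simp add: frobenius_monoid_def)
  have counit: "(\<iota> A \<otimes> e\<^sup>\<dagger>) \<cdot> m\<^sup>\<dagger> = (\<r> A)\<^sup>\<dagger>"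
    using mult_right_unit[THEN dagger_eqD] by simp
  have "transposed_comult = \<r> A \<cdot> (\<iota> A \<otimes> e\<^sup>\<dagger>) \<cdot> (\<iota> A \<otimes> m) \<cdot> \<alpha> A A A \<cdot> (m\<^sup>\<dagger> \<otimes> \<iota> A)"
    by (simp add: transposed_comult_def pairing_def fuse)
  also have "\<dots> = \<r> A \<cdot> (\<iota> A \<otimes> e\<^sup>\<dagger>) \<cdot> (m \<otimes> \<iota> A) \<cdot> (\<alpha> A A A)\<^sup>\<dagger> \<cdot> (\<iota> A \<otimes> m\<^sup>\<dagger>)"
    by (simp only: F)
  also have "\<dots> = \<r> A \<cdot> (m \<otimes> \<iota> \<one>) \<cdot> ((\<iota> A \<otimes> \<iota> A) \<otimes> e\<^sup>\<dagger>) \<cdot> (\<alpha> A A A)\<^sup>\<dagger> \<cdot> (\<iota> A \<otimes> m\<^sup>\<dagger>)"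
    by (simp add: fuse)
  also have "\<dots> = m \<cdot> \<r> (A \<odot> A) \<cdot> (\<alpha> A A \<one>)\<^sup>\<dagger> \<cdot> (\<iota> A \<otimes> (\<iota> A \<otimes> e\<^sup>\<dagger>)) \<cdot> (\<iota> A \<otimes> m\<^sup>\<dagger>)"
    by (simp add: right_unitor_nat[THEN eq_compD] dagger_associator_nat[THEN eq_compD])
  also have "\<dots> = m \<cdot> (\<iota> A \<otimes> \<r> A) \<cdot> (\<iota> A \<otimes> ((\<iota> A \<otimes> e\<^sup>\<dagger>) \<cdot> m\<^sup>\<dagger>))"
    by (simp add: right_unitor_tensor[symmetric] fuse)
  also have "\<dots> = m"
    unfolding counit by (simp add: fuse)
  finally show ?thesis by simp
qed

text \<open>Two expressions for \<open>m\<^sup>\<dagger>\<close> are used: \<open>d\<close>, the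
  dagger of the hypothesis, and its mirror image \<open>d'\<close>. Expanding one side of the law by
  \<open>d\<close> produces two multiplications that can be exchanged, after which \<open>d'\<close>
  reassembles \<open>m\<^sup>\<dagger>\<close> on the other side.\<close>

lemma transposed_comult_imp_frobenius:
  assumes m: "m = transposed_comult"
  shows "frobenius_monoid C A m e"
proof -
  have d: "m\<^sup>\<dagger> = (m \<otimes> \<iota> A) \<cdot> (\<alpha> A A A)\<^sup>\<dagger> \<cdot> (\<iota> A \<otimes> pairing\<^sup>\<dagger>) \<cdot> (\<r> A)\<^sup>\<dagger>"
    using m[unfolded transposed_comult_def, THEN dagger_eqD] by simp
  have snake: "\<l> A \<cdot> (pairing \<otimes> \<iota> A) \<cdot> (\<alpha> A A A)\<^sup>\<dagger> \<cdot> (\<iota> A \<otimes> pairing\<^sup>\<dagger>) \<cdot> (\<r> A)\<^sup>\<dagger> = \<iota> A"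
    using pairing_snake[OF m, THEN dagger_eqD] by simp
  have p: "pairing \<cdot> (\<iota> A \<otimes> m) = pairing \<cdot> (m \<otimes> \<iota> A) \<cdot> (\<alpha> A A A)\<^sup>\<dagger>"
    by (simp add: pairing_assoc[THEN eq_compD])
  \<comment> \<open>This chain proves the mirror image of the hypothesis:
    \<open>m\<^sup>\<dagger>\<close> is expanded by \<open>d\<close>, associativity of the pairing
    moves the multiplication clear of the snake, and the snake cancels.\<close>
  have "\<l> A \<cdot> (pairing \<otimes> \<iota> A) \<cdot> (\<alpha> A A A)\<^sup>\<dagger> \<cdot> (\<iota> A \<otimes> m\<^sup>\<dagger>)
      = \<l> A \<cdot> (pairing \<otimes> \<iota> A) \<cdot> (\<alpha> A A A)\<^sup>\<dagger> \<cdot> (\<iota> A \<otimes> (m \<otimes> \<iota> A)) \<cdot> (\<iota> A \<otimes> (\<alpha> A A A)\<^sup>\<dagger>)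
          \<cdot> (\<iota> A \<otimes> (\<iota> A \<otimes> pairing\<^sup>\<dagger>)) \<cdot> (\<iota> A \<otimes> (\<r> A)\<^sup>\<dagger>)"
    by (subst d) (simp add: fuse)
  also have "\<dots> = \<l> A \<cdot> ((pairing \<cdot> (\<iota> A \<otimes> m)) \<otimes> \<iota> A) \<cdot> (\<alpha> A (A \<odot> A) A)\<^sup>\<dagger> \<cdot> (\<iota> A \<otimes> (\<alpha> A A A)\<^sup>\<dagger>)
          \<cdot> (\<iota> A \<otimes> (\<iota> A \<otimes> pairing\<^sup>\<dagger>)) \<cdot> (\<iota> A \<otimes> (\<r> A)\<^sup>\<dagger>)"
    by (subst dagger_associator_nat[THEN eq_compD]) (simp_all add: fuse)
  also have "\<dots> = \<l> A \<cdot> (pairing \<otimes> \<iota> A) \<cdot> ((m \<otimes> \<iota> A) \<otimes> \<iota> A)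
          \<cdot> (((\<alpha> A A A)\<^sup>\<dagger> \<otimes> \<iota> A) \<cdot> (\<alpha> A (A \<odot> A) A)\<^sup>\<dagger> \<cdot> (\<iota> A \<otimes> (\<alpha> A A A)\<^sup>\<dagger>))
          \<cdot> (\<iota> A \<otimes> (\<iota> A \<otimes> pairing\<^sup>\<dagger>)) \<cdot> (\<iota> A \<otimes> (\<r> A)\<^sup>\<dagger>)"
    unfolding p by (simp add: fuse)
  also have "\<dots> = \<l> A \<cdot> (pairing \<otimes> \<iota> A) \<cdot> ((m \<otimes> \<iota> A) \<otimes> \<iota> A)
          \<cdot> ((\<alpha> (A \<odot> A) A A)\<^sup>\<dagger> \<cdot> (\<alpha> A A (A \<odot> A))\<^sup>\<dagger>)
          \<cdot> (\<iota> A \<otimes> (\<iota> A \<otimes> pairing\<^sup>\<dagger>)) \<cdot> (\<iota> A \<otimes> (\<r> A)\<^sup>\<dagger>)"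
    by (subst dagger_pentagon) simp_all
  also have "\<dots> = \<l> A \<cdot> (pairing \<otimes> \<iota> A) \<cdot> (\<alpha> A A A)\<^sup>\<dagger> \<cdot> (m \<otimes> \<iota> (A \<odot> A))
          \<cdot> (\<iota> (A \<odot> A) \<otimes> pairing\<^sup>\<dagger>) \<cdot> (\<alpha> A A \<one>)\<^sup>\<dagger> \<cdot> (\<iota> A \<otimes> (\<r> A)\<^sup>\<dagger>)"
    by (simp add: dagger_associator_nat[THEN eq_compD] dagger_associator_nat_ident[THEN eq_compD])
  also have "\<dots> = \<l> A \<cdot> (pairing \<otimes> \<iota> A) \<cdot> (\<alpha> A A A)\<^sup>\<dagger> \<cdot> (\<iota> A \<otimes> pairing\<^sup>\<dagger>)
          \<cdot> (m \<otimes> \<iota> \<one>) \<cdot> (\<r> (A \<odot> A))\<^sup>\<dagger>"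
    by (simp add: dagger_right_unitor_tensor fuse)
  also have "\<dots> = (\<l> A \<cdot> (pairing \<otimes> \<iota> A) \<cdot> (\<alpha> A A A)\<^sup>\<dagger> \<cdot> (\<iota> A \<otimes> pairing\<^sup>\<dagger>) \<cdot> (\<r> A)\<^sup>\<dagger>) \<cdot> m"
    by (simp add: dagger_right_unitor_nat)
  also have "\<dots> = m"
    unfolding snake by simp
  finally have "\<l> A \<cdot> (pairing \<otimes> \<iota> A) \<cdot> (\<alpha> A A A)\<^sup>\<dagger> \<cdot> (\<iota> A \<otimes> m\<^sup>\<dagger>) = m" .
  from this[THEN dagger_eqD]
  have d': "(\<iota> A \<otimes> m) \<cdot> \<alpha> A A A \<cdot> (pairing\<^sup>\<dagger> \<otimes> \<iota> A) \<cdot> (\<l> A)\<^sup>\<dagger> = m\<^sup>\<dagger>"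
    by simp
  have "(\<iota> A \<otimes> m) \<cdot> \<alpha> A A A \<cdot> (m\<^sup>\<dagger> \<otimes> \<iota> A)
      = (\<iota> A \<otimes> m) \<cdot> \<alpha> A A A \<cdot> ((m \<otimes> \<iota> A) \<otimes> \<iota> A) \<cdot> ((\<alpha> A A A)\<^sup>\<dagger> \<otimes> \<iota> A)
          \<cdot> ((\<iota> A \<otimes> pairing\<^sup>\<dagger>) \<otimes> \<iota> A) \<cdot> ((\<r> A)\<^sup>\<dagger> \<otimes> \<iota> A)"
    by (subst d) (simp add: fuse)
  also have "\<dots> = (\<iota> A \<otimes> m) \<cdot> (m \<otimes> \<iota> (A \<odot> A)) \<cdot> (\<alpha> (A \<odot> A) A A \<cdot> ((\<alpha> A A A)\<^sup>\<dagger> \<otimes> \<iota> A)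
          \<cdot> (\<alpha> A (A \<odot> A) A)\<^sup>\<dagger>) \<cdot> (\<iota> A \<otimes> (pairing\<^sup>\<dagger> \<otimes> \<iota> A)) \<cdot> (\<iota> A \<otimes> (\<l> A)\<^sup>\<dagger>)"
    by (simp add: associator_nat[THEN eq_compD] dagger_associator_nat[THEN eq_compD] dagger_triangle)
  also have "\<dots> = (\<iota> A \<otimes> m) \<cdot> (m \<otimes> \<iota> (A \<odot> A)) \<cdot> ((\<alpha> A A (A \<odot> A))\<^sup>\<dagger> \<cdot> (\<iota> A \<otimes> \<alpha> A A A))
          \<cdot> (\<iota> A \<otimes> (pairing\<^sup>\<dagger> \<otimes> \<iota> A)) \<cdot> (\<iota> A \<otimes> (\<l> A)\<^sup>\<dagger>)"
    by (subst pentagon_mixed) simp_all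
  \<comment> \<open>The two multiplications act on separate pairs of wires, so interchange lets the
    right one go first.\<close>
  also have "\<dots> = (m \<otimes> \<iota> A) \<cdot> ((\<iota> A \<otimes> \<iota> A) \<otimes> m) \<cdot> (\<alpha> A A (A \<odot> A))\<^sup>\<dagger> \<cdot> (\<iota> A \<otimes> \<alpha> A A A)
          \<cdot> (\<iota> A \<otimes> (pairing\<^sup>\<dagger> \<otimes> \<iota> A)) \<cdot> (\<iota> A \<otimes> (\<l> A)\<^sup>\<dagger>)"
    by (simp add: fuse)
  also have "\<dots> = (m \<otimes> \<iota> A) \<cdot> (\<alpha> A A A)\<^sup>\<dagger> \<cdot> (\<iota> A \<otimes> (\<iota> A \<otimes> m)) \<cdot> (\<iota> A \<otimes> \<alpha> A A A)
          \<cdot> (\<iota> A \<otimes> (pairing\<^sup>\<dagger> \<otimes> \<iota> A)) \<cdot> (\<iota> A \<otimes> (\<l> A)\<^sup>\<dagger>)"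
    by (simp add: dagger_associator_nat[THEN eq_compD])
  also have "\<dots> = (m \<otimes> \<iota> A) \<cdot> (\<alpha> A A A)\<^sup>\<dagger> \<cdot> (\<iota> A \<otimes> ((\<iota> A \<otimes> m) \<cdot> \<alpha> A A A \<cdot> (pairing\<^sup>\<dagger> \<otimes> \<iota> A) \<cdot> (\<l> A)\<^sup>\<dagger>))"
    by (simp add: fuse)
  finally show ?thesis
    unfolding d' using monoid_in by (simp add: frobenius_monoid_def)
qed

lemma frobenius_iff_transposed_comult: "frobenius_monoid C A m e \<longleftrightarrow> m = transposed_comult"
  using frobenius_imp_transposed_comult transposed_comult_imp_frobenius by blast

section \<open>The involutive conditions in terms of \<open>m = transposed_comult\<close>\<close>

lemma involutive_monoid_i:
  assumes "m = transposed_comult"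
  shows "involutive_monoid C A m e i"
  using i_mult[OF assms] conjugate_i_i[OF assms]
  by (simp add: involutive_monoid_def monoid_hom_def monoid_in in_hom_iff i_unit)

text \<open>Multiplication and unit are preserved by \<open>R_mult\<close> and
  \<open>R_unit\<close>, and the target involution is the identity, so what remains is the equation
  treated in \<open>R_eq_conjugate_R_i_iff\<close>.\<close>

lemma involutive_monoid_hom_R_iff:
  "involutive_monoid_hom C A m e i (A\<^sup>\<star> \<odot> A) (pants_mult C A) (pants_unit C A) (\<iota> (A\<^sup>\<star> \<odot> A)) R
    \<longleftrightarrow> m = transposed_comult"
  unfolding R_eq_conjugate_R_i_iff[symmetric] involutive_monoid_hom_def monoid_hom_def
  using R_mult R_unit by (simp add: in_hom_iff)

end

theorem theorem3p8:
  fixes C :: "('o, 'a, 'z) compact_dagger_data_scheme" (structure)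
    and A :: 'o and m e i R :: 'a
  assumes "compact_dagger_category C"
    and "monoid_in C A m e"
    and "i = induced_involution C A m e"
    and "R = cayley_embedding C A m"
  shows "frobenius_monoid C A m e \<longleftrightarrow>
    involutive_monoid C A m e i \<and>
    involutive_monoid_hom C A m e i
      (A\<^sup>\<star> \<odot> A) (pants_mult C A) (pants_unit C A) (ident C (A\<^sup>\<star> \<odot> A)) R"
proof -
  interpret M: monoid_in_compact C A m e
    using assms(1,2) by (simp add: monoid_in_compact_def monoid_in_compact_axioms_def)
  have "i = M.i" "R = M.R"
    using assms(3,4) by (simp_all add: M.i_def M.R_def)
  \<comment> \<open>The equation \<open>m = transposed_comult\<close> is equivalent to the Frobenius
    law and to the homomorphism condition on \<open>R\<close>, and it implies the condition on
    \<open>i\<close>.\<close>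
  then show ?thesis
    using M.frobenius_iff_transposed_comult M.involutive_monoid_i M.involutive_monoid_hom_R_iff by metis
qed

end
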